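(* The space $(M\times I,d_p,\nu\times\mathcal{L}^1)$ is an approximate differentiability space. The structure consists of the single chart $(M\times I,h)$, where $h\colon M\times I\to\mathbb{R}$ is the height function $h(x,t)=t$, and for each Lipschitz map $f\colon(M\times I,d_p)\to\mathbb{R}$ and almost every $(x_0,t_0)\in M\times I$ the (approximate) derivative of $f$ at $(x_0,t_0)$ with respect to this chart is given by \[df(x_0,t_0):=\lim_{u\to0}\frac{f(x_0,t_0+u)-f(x_0,t_0)}{u}.\]
   Context: Let $M:=\{(a_1,a_2,a_3,\ldots):a_i\in\{1,\ldots,i\}\}$ with the metric $d_M(a,b)=1/2^k$ where $k=\min\{i:a_i\neq b_i\}$ for $a\ne b$ (and $d_M(a,a)=0$). For $k\ge1$, an island of level $k$ is a set of all sequences in $M$ with prescribed first $k$ coordinates. Let $\nu$ be the Borel probability measure on $M$ giving every island of level $k$ the measure $\nu_k=1/k!$. Let $I=[0,1]$, let $\mathcal{L}^1$ be Lebesgue measure on $I$, and for integers $k\ge0$ let $I_k:=\{n/2^k:n\in\mathbb{Z},\ 0\le n\le 2^k\}$. Define the pseudometric $d_p$ on $M\times I$ by \[d_p((x,t),(y,s)):=\inf\{|t-u|+|u-s|: u\in I_k \text{ for some integer } k\ge 0 \text{ with } d_M(x,y)<1/2^k\}.\] The space $(M\times I,d_p)$ is complete and separable, and $\nu\times\mathcal{L}^1$ is a Borel measure on it. Let $(X,d)$ be a complete separable (pseudo)metric space with a locally finite Borel measure $\mu$. A chart of dimension $n\in\mathbb{N}$ is a pair $(U,\varphi)$ with $U\subset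 X$ Borel and $\varphi\colon X\to\mathbb{R}^n$ Lipschitz. A function $g$ has approximate limit $l\in\mathbb{R}$ at $x_0\in X$ if for every $\varepsilon>0$ \[\lim_{r\downarrow0}\frac{\mu\{x\in B(x_0,r):|g(x)-l|>\varepsilon\}}{\mu(B(x_0,r))}=0\] (points where $g$ is undefined, e.g. $x=x_0$ in the quotient below, are disregarded). $(X,d,\mu)$ is an approximate differentiability space if there is a countable decomposition of $X$ into charts such that for every Lipschitz $f\colon X\to\mathbb{R}$, every chart $(U,\varphi)$ of dimension $n$ in the decomposition and almost every $x_0\in U$, there exists a unique $df(x_0)\in\mathbb{R}^n$ (the derivative) such that \[x\mapsto\frac{|f(x)-f(x_0)-df(x_0)\cdot(\varphi(x)-\varphi(x_0))|}{d(x,x_0)}\] has approximate limit $0$ at $x_0$. *)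

theory Defs
  imports "HOL-Probability.Probability"
begin

section \<open>Pseudometric measure spaces\<close>

definition pseudometric_on :: "'a set \<Rightarrow> ('a \<Rightarrow> 'a \<Rightarrow> real) \<Rightarrow> bool" where
  "pseudometric_on X d \<longleftrightarrow>
     (\<forall>x\<in>X. d x x = 0) \<and>
     (\<forall>x\<in>X. \<forall>y\<in>X. 0 \<le> d x y \<and> d x y = d y x) \<and>
     (\<forall>x\<in>X. \<forall>y\<in>X. \<forall>z\<in>X. d x z \<le> d x y + d y z)"

definition pm_ball :: "'a set \<Rightarrow> ('a \<Rightarrow> 'a \<Rightarrow> real) \<Rightarrow> 'a \<Rightarrow> real \<Rightarrow> 'a set" where
  "pm_ball X d x r = {y \<in> X. d x y < r}"

definition pm_open :: "'a set \<Rightarrow> ('a \<Rightarrow> 'a \<Rightarrow> real) \<Rightarrow> 'a set \<Rightarrow> bool" where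
  "pm_open X d U \<longleftrightarrow> U \<subseteq> X \<and> (\<forall>x\<in>U. \<exists>r>0. pm_ball X d x r \<subseteq> U)"

definition pm_borel_sets :: "'a set \<Rightarrow> ('a \<Rightarrow> 'a \<Rightarrow> real) \<Rightarrow> 'a set set" where
  "pm_borel_sets X d = sigma_sets X {U. pm_open X d U}"

definition pm_complete :: "'a set \<Rightarrow> ('a \<Rightarrow> 'a \<Rightarrow> real) \<Rightarrow> bool" where
  "pm_complete X d \<longleftrightarrow>
     (\<forall>\<sigma>::nat \<Rightarrow> 'a. range \<sigma> \<subseteq> X \<and>
        (\<forall>\<epsilon>>0. \<exists>N. \<forall>m\<ge>N. \<forall>n\<ge>N. d (\<sigma> m) (\<sigma> n) < \<epsilon>) \<longrightarrow>
        (\<exists>x\<in>X. (\<lambda>n. d (\<sigma> n) x) \<longlonglongrightarrow> 0))"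

definition pm_separable :: "'a set \<Rightarrow> ('a \<Rightarrow> 'a \<Rightarrow> real) \<Rightarrow> bool" where
  "pm_separable X d \<longleftrightarrow>
     (\<exists>S. countable S \<and> S \<subseteq> X \<and> (\<forall>x\<in>X. \<forall>\<epsilon>>0. \<exists>s\<in>S. d x s < \<epsilon>))"

text \<open>As usual in geometric measure theory, \<open>\<mu>\<close> is a Borel measure if all Borel sets are
  \<open>\<mu>\<close>-measurable; its \<open>\<sigma>\<close>-algebra may be larger than the Borel one. This matters for a
  proper pseudometric, whose Borel sets do not separate points at distance zero.\<close>

definition pm_measure_space :: "'a set \<Rightarrow> ('a \<Rightarrow> 'a \<Rightarrow> real) \<Rightarrow> 'a measure \<Rightarrow> bool" where
  "pm_measure_space X d \<mu> \<longleftrightarrow>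
     pseudometric_on X d \<and> pm_complete X d \<and> pm_separable X d \<and>
     space \<mu> = X \<and> pm_borel_sets X d \<subseteq> sets \<mu> \<and>
     (\<forall>x\<in>X. \<exists>r>0. emeasure \<mu> (pm_ball X d x r) < \<infinity>)"

section \<open>Approximate differentiability spaces\<close>

text \<open>\<open>\<real>\<^sup>n\<close>, with \<open>n\<close> varying from chart to chart, is encoded as the carrier of
  \<^const>\<open>Euclidean_space\<close>: functions \<open>nat \<Rightarrow> real\<close> vanishing at all indices \<open>\<ge> n\<close>.\<close>

abbreviation Rn :: "nat \<Rightarrow> (nat \<Rightarrow> real) set" where
  "Rn n \<equiv> topspace (Euclidean_space n)"

definition euclid_dist :: "nat \<Rightarrow> (nat \<Rightarrow> real) \<Rightarrow> (nat \<Rightarrow> real) \<Rightarrow> real" where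
  "euclid_dist n v w = L2_set (\<lambda>i. v i - w i) {..<n}"

definition euclid_inner :: "nat \<Rightarrow> (nat \<Rightarrow> real) \<Rightarrow> (nat \<Rightarrow> real) \<Rightarrow> real" where
  "euclid_inner n v w = (\<Sum>i<n. v i * w i)"

definition pm_lipschitz ::
    "'a set \<Rightarrow> ('a \<Rightarrow> 'a \<Rightarrow> real) \<Rightarrow> ('b \<Rightarrow> 'b \<Rightarrow> real) \<Rightarrow> ('a \<Rightarrow> 'b) \<Rightarrow> bool" where
  "pm_lipschitz X d e f \<longleftrightarrow> (\<exists>L\<ge>0. \<forall>x\<in>X. \<forall>y\<in>X. e (f x) (f y) \<le> L * d x y)"

type_synonym 'a chart = "nat \<times> 'a set \<times> ('a \<Rightarrow> nat \<Rightarrow> real)"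

definition is_chart :: "'a set \<Rightarrow> ('a \<Rightarrow> 'a \<Rightarrow> real) \<Rightarrow> 'a chart \<Rightarrow> bool" where
  "is_chart X d = (\<lambda>(n, U, \<phi>).
     U \<in> pm_borel_sets X d \<and> \<phi> \<in> X \<rightarrow> Rn n \<and> pm_lipschitz X d (euclid_dist n) \<phi>)"

text \<open>The set \<open>A\<close> is the domain of \<open>g\<close>; points outside it are disregarded. The outer measure
  agrees with \<open>\<mu>\<close> on measurable sets, and prevents the condition from becoming void
  for a non-measurable \<open>g\<close>, since \<^const>\<open>emeasure\<close> vanishes on non-measurable sets.\<close>

definition has_approx_limit ::
    "'a set \<Rightarrow> ('a \<Rightarrow> 'a \<Rightarrow> real) \<Rightarrow> 'a measure \<Rightarrow> 'a set \<Rightarrow> ('a \<Rightarrow> real) \<Rightarrow> 'a \<Rightarrow> real \<Rightarrow> bool" where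
  "has_approx_limit X d \<mu> A g x\<^sub>0 l \<longleftrightarrow>
     (\<forall>\<epsilon>>0. ((\<lambda>r. outer_measure_of \<mu> {x \<in> pm_ball X d x\<^sub>0 r \<inter> A. \<bar>g x - l\<bar> > \<epsilon>}
                  / emeasure \<mu> (pm_ball X d x\<^sub>0 r)) \<longlongrightarrow> 0) (at_right 0))"

definition has_approx_derivative ::
    "'a set \<Rightarrow> ('a \<Rightarrow> 'a \<Rightarrow> real) \<Rightarrow> 'a measure \<Rightarrow> 'a chart \<Rightarrow> ('a \<Rightarrow> real) \<Rightarrow> 'a \<Rightarrow>
       (nat \<Rightarrow> real) \<Rightarrow> bool" where
  "has_approx_derivative X d \<mu> = (\<lambda>(n, U, \<phi>) f x\<^sub>0 D.
     D \<in> Rn n \<and>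
     has_approx_limit X d \<mu> {x \<in> X. d x x\<^sub>0 \<noteq> 0}
       (\<lambda>x. \<bar>f x - f x\<^sub>0 - euclid_inner n D (\<lambda>i. \<phi> x i - \<phi> x\<^sub>0 i)\<bar> / d x x\<^sub>0) x\<^sub>0 0)"

definition approx_diff_structure ::
    "'a set \<Rightarrow> ('a \<Rightarrow> 'a \<Rightarrow> real) \<Rightarrow> 'a measure \<Rightarrow> 'a chart set \<Rightarrow> bool" where
  "approx_diff_structure X d \<mu> \<C> \<longleftrightarrow>
     countable \<C> \<and> (\<forall>c\<in>\<C>. is_chart X d c) \<and>
     (\<Union>(n, U, \<phi>)\<in>\<C>. U) = X \<and> disjoint_family_on (\<lambda>(n, U, \<phi>). U) \<C> \<and>
     (\<forall>f::'a \<Rightarrow> real. pm_lipschitz X d dist f \<longrightarrow>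
        (\<forall>(n, U, \<phi>)\<in>\<C>. AE x\<^sub>0 in \<mu>. x\<^sub>0 \<in> U \<longrightarrow>
           (\<exists>!D. has_approx_derivative X d \<mu> (n, U, \<phi>) f x\<^sub>0 D)))"

definition approx_diff_space ::
    "'a set \<Rightarrow> ('a \<Rightarrow> 'a \<Rightarrow> real) \<Rightarrow> 'a measure \<Rightarrow> bool" where
  "approx_diff_space X d \<mu> \<longleftrightarrow>
     pm_measure_space X d \<mu> \<and> (\<exists>\<C>. approx_diff_structure X d \<mu> \<C>)"

section \<open>The space of sequences and its measure\<close>

text \<open>Coordinates are indexed from 1; the irrelevant value at 0 is pinned by \<^const>\<open>PiE\<close>.\<close>

definition M_seq :: "(nat \<Rightarrow> nat) set" where
  "M_seq = (\<Pi>\<^sub>E i\<in>{1..}. {1..i})"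

definition d_M :: "(nat \<Rightarrow> nat) \<Rightarrow> (nat \<Rightarrow> nat) \<Rightarrow> real" where
  "d_M a b = (if a = b then 0 else 1 / 2 ^ (LEAST i. 1 \<le> i \<and> a i \<noteq> b i))"

definition island :: "nat \<Rightarrow> (nat \<Rightarrow> nat) \<Rightarrow> (nat \<Rightarrow> nat) set" where
  "island k a = {b \<in> M_seq. \<forall>i\<in>{1..k}. b i = a i}"

definition is_island_measure :: "(nat \<Rightarrow> nat) measure \<Rightarrow> bool" where
  "is_island_measure \<nu> \<longleftrightarrow>
     space \<nu> = M_seq \<and> sets \<nu> = pm_borel_sets M_seq d_M \<and> prob_space \<nu> \<and>
     (\<forall>k\<ge>1. \<forall>a\<in>M_seq. emeasure \<nu> (island k a) = ennreal (1 / fact k))"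

text \<open>Existence and uniqueness are proved in \<open>ex1_island_measure\<close> below.\<close>

definition nu :: "(nat \<Rightarrow> nat) measure" where
  "nu = (THE \<nu>. is_island_measure \<nu>)"

section \<open>The space \<open>M \<times> I\<close>\<close>

definition I_dyadic :: "nat \<Rightarrow> real set" where
  "I_dyadic k = {real_of_int n / 2 ^ k | n. 0 \<le> n \<and> n \<le> 2 ^ k}"

definition MI :: "((nat \<Rightarrow> nat) \<times> real) set" where
  "MI = M_seq \<times> {0..1}"

definition d_p :: "(nat \<Rightarrow> nat) \<times> real \<Rightarrow> (nat \<Rightarrow> nat) \<times> real \<Rightarrow> real" where
  "d_p = (\<lambda>(x, t) (y, s).
     Inf {\<bar>t - u\<bar> + \<bar>u - s\<bar> | u. \<exists>k. u \<in> I_dyadic k \<and> d_M x y < 1 / 2 ^ k})"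

definition mu :: "((nat \<Rightarrow> nat) \<times> real) measure" where
  "mu = nu \<Otimes>\<^sub>M restrict_space lborel {0..1}"

text \<open>Real numbers as elements of \<open>\<real>\<^sup>1\<close>.\<close>

definition vec1 :: "real \<Rightarrow> nat \<Rightarrow> real" where
  "vec1 r = (\<lambda>i. if i = 0 then r else 0)"

definition height :: "(nat \<Rightarrow> nat) \<times> real \<Rightarrow> real" where
  "height = (\<lambda>(x, t). t)"

definition height_chart :: "((nat \<Rightarrow> nat) \<times> real) chart" where
  "height_chart = (1, MI, \<lambda>z. vec1 (height z))"

section \<open>Existence and uniqueness of the measure on \<open>M\<close>\<close>

lemma M_range: "a \<in> M_seq \<Longrightarrow> 1 \<le> i \<Longrightarrow> 1 \<le> a i \<and> a i \<le> i"
  by (auto simp: M_seq_def PiE_iff)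

lemma M_ext: "a \<in> M_seq \<Longrightarrow> b \<in> M_seq \<Longrightarrow> (\<And>i. 1 \<le> i \<Longrightarrow> a i = b i) \<Longrightarrow> a = b"
  unfolding M_seq_def by (rule PiE_ext) auto

lemma M_nonempty: "\<exists>a. a \<in> M_seq"
proof -
  have "M_seq \<noteq> {}" by (auto simp: M_seq_def PiE_eq_empty_iff)
  then show ?thesis by auto
qed

lemma ball_M:
  assumes a: "a \<in> M_seq"
  shows "pm_ball M_seq d_M a (1 / 2 ^ k) = island k a"
proof -
  have "d_M a b < 1 / 2 ^ k \<longleftrightarrow> (\<forall>i\<in>{1..k}. b i = a i)" if b: "b \<in> M_seq" for b
  proof (cases "a = b")
    case True
    then show ?thesis by (auto simp: d_M_def)
  next
    case False
    define m where "m = (LEAST i. 1 \<le> i \<and> a i \<noteq> b i)"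
    from False obtain j where j: "1 \<le> j \<and> a j \<noteq> b j"
      using M_ext[OF a b] by blast
    have m: "1 \<le> m \<and> a m \<noteq> b m"
      unfolding m_def by (rule LeastI[of _ j]) (rule j)
    have least: "a i = b i" if "1 \<le> i" "i < m" for i
      using not_less_Least[of i "\<lambda>i. 1 \<le> i \<and> a i \<noteq> b i"] that by (auto simp: m_def)
    have "d_M a b < 1 / 2 ^ k \<longleftrightarrow> k < m"
      using False unfolding d_M_def m_def[symmetric] by (simp add: field_simps)
    also have "\<dots> \<longleftrightarrow> (\<forall>i\<in>{1..k}. b i = a i)"
    proof
      assume "k < m"
      then show "\<forall>i\<in>{1..k}. b i = a i" using least by auto
    next
      assume *: "\<forall>i\<in>{1..k}. b i = a i"
      show "k < m"
      proof (rule ccontr)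
        assume "\<not> k < m"
        then have "b m = a m" using * m by auto
        then show False using m by auto
      qed
    qed
    finally show ?thesis .
  qed
  then show ?thesis by (auto simp: pm_ball_def island_def)
qed

lemma island_cong: "(\<And>i. 1 \<le> i \<Longrightarrow> i \<le> k \<Longrightarrow> a i = b i) \<Longrightarrow> island k a = island k b"
  by (auto simp: island_def)

lemma island_self: "a \<in> M_seq \<Longrightarrow> a \<in> island k a"
  by (auto simp: island_def)

lemma island_open:
  shows "pm_open M_seq d_M (island k a)"
  unfolding pm_open_def
proof (intro conjI ballI)
  show "island k a \<subseteq> M_seq" by (auto simp: island_def)
  fix b assume b: "b \<in> island k a"
  then have "pm_ball M_seq d_M b (1 / 2 ^ k) = island k b"
    by (intro ball_M) (auto simp: island_def)
  also have "\<dots> = island k a"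
    using b by (intro island_cong) (auto simp: island_def)
  finally show "\<exists>r>0. pm_ball M_seq d_M b r \<subseteq> island k a"
    by (intro exI[of _ "1 / 2 ^ k"]) auto
qed

definition islands :: "(nat \<Rightarrow> nat) set set" where
  "islands = {island k a | k a. 1 \<le> k \<and> a \<in> M_seq}"

lemma countable_islands: "countable islands"
proof -
  have "countable {island k a | a. a \<in> M_seq}" for k
  proof -
    have "finite (Pi\<^sub>E {1..k} (\<lambda>i. {1..i}))"
      by (intro finite_PiE) auto
    moreover have "{island k a | a. a \<in> M_seq} \<subseteq> island k ` (Pi\<^sub>E {1..k} (\<lambda>i. {1..i}))"
    proof clarify
      fix a assume a: "a \<in> M_seq"
      have "restrict a {1..k} \<in> Pi\<^sub>E {1..k} (\<lambda>i. {1..i})"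
        using M_range[OF a] by auto
      moreover have "island k a = island k (restrict a {1..k})"
        by (rule island_cong) auto
      ultimately show "island k a \<in> island k ` (Pi\<^sub>E {1..k} (\<lambda>i. {1..i}))" by blast
    qed
    ultimately show ?thesis
      by (meson countable_finite finite_imageI finite_subset)
  qed
  then have "countable (\<Union>k. {island k a | a. a \<in> M_seq})" by blast
  then show ?thesis
    by (rule countable_subset[rotated]) (auto simp: islands_def)
qed

lemma islands_Pow: "islands \<subseteq> Pow M_seq"
  by (auto simp: islands_def island_def)

lemma M_in_islands: "M_seq \<in> islands"
proof -
  obtain a where a: "a \<in> M_seq" using M_nonempty by blast
  have one: "b (Suc 0) = Suc 0" if "b \<in> M_seq" for b
    using M_range[OF that, of 1] by auto
  have "island 1 a = M_seq"
    using one[OF a] by (auto simp: island_def one)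
  then show ?thesis using a unfolding islands_def by (metis (mono_tags, lifting) mem_Collect_eq order_refl)
qed

lemma open_Union_islands:
  assumes "pm_open M_seq d_M U"
  shows "U = \<Union>{J \<in> islands. J \<subseteq> U}"
proof (intro equalityI subsetI)
  fix a assume aU: "a \<in> U"
  then have a: "a \<in> M_seq" using assms by (auto simp: pm_open_def)
  from aU assms obtain r where r: "r > 0" "pm_ball M_seq d_M a r \<subseteq> U"
    by (auto simp: pm_open_def)
  obtain k where k: "(1 / 2) ^ k < r"
    using real_arch_pow_inv[of r "1/2"] r by auto
  have "(1 / 2) ^ Suc k < r"
    using k r(1) by (auto intro: le_less_trans[OF power_decreasing[of k "Suc k" "1/2::real"]])
  then have "pm_ball M_seq d_M a (1 / 2 ^ Suc k) \<subseteq> pm_ball M_seq d_M a r"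
    by (auto simp: pm_ball_def power_divide)
  then have "island (Suc k) a \<subseteq> U"
    using ball_M[OF a, of "Suc k"] r by auto
  moreover have "island (Suc k) a \<in> islands"
    using a by (auto simp: islands_def)
  ultimately show "a \<in> \<Union>{J \<in> islands. J \<subseteq> U}"
    using island_self[OF a] by blast
qed auto

lemma borel_M_eq: "pm_borel_sets M_seq d_M = sigma_sets M_seq islands"
proof -
  have "U \<in> sigma_sets M_seq islands" if "pm_open M_seq d_M U" for U
  proof -
    have "\<Union>{J \<in> islands. J \<subseteq> U} \<in> sigma_sets M_seq islands"
      using countable_islands
      by (intro sigma_sets_UNION) (auto intro: countable_subset)
    then show ?thesis using open_Union_islands[OF that] by simp
  qed
  moreover have "J \<in> sigma_sets M_seq {U. pm_open M_seq d_M U}" if "J \<in> islands" for J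
    using that island_open by (auto simp: islands_def)
  ultimately show ?thesis
    unfolding pm_borel_sets_def by (intro sigma_sets_eqI) auto
qed

lemma Int_stable_islands: "Int_stable (insert {} islands)"
proof -
  have "island k a \<inter> island l b \<in> insert {} islands"
    if "1 \<le> k" "1 \<le> l" "a \<in> M_seq" "b \<in> M_seq" for k l a b
  proof (cases "island k a \<inter> island l b = {}")
    case False
    then obtain c where c: "c \<in> island k a" "c \<in> island l b" by blast
    then have "c \<in> M_seq" by (auto simp: island_def)
    have "island k a = island k c" "island l b = island l c"
      using c by (auto intro!: island_cong simp: island_def)
    then have "island k a \<inter> island l b = island (max k l) c"
      by (auto simp: island_def le_max_iff_disj)
    then show ?thesis using that \<open>c \<in> M_seq\<close>
      unfolding islands_def by (metis (mono_tags, lifting) insertCI max.coboundedI1 mem_Collect_eq)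
  qed simp
  then show ?thesis
    unfolding Int_stable_def islands_def by blast
qed

lemma island_measure_unique:
  assumes "is_island_measure \<nu>" "is_island_measure \<nu>'"
  shows "\<nu> = \<nu>'"
proof (rule measure_eqI_generator_eq[where E = "insert {} islands" and \<Omega> = M_seq and A = "\<lambda>_. M_seq"])
  have *: "sigma_sets M_seq (insert {} islands) = sigma_sets M_seq islands"
    by (intro sigma_sets_eqI) (auto intro: sigma_sets.Empty)
  show "sets \<nu> = sigma_sets M_seq (insert {} islands)" "sets \<nu>' = sigma_sets M_seq (insert {} islands)"
    using assms unfolding * by (auto simp: is_island_measure_def borel_M_eq)
  show "emeasure \<nu> X = emeasure \<nu>' X" if "X \<in> insert {} islands" for X
    using that assms by (auto simp: islands_def is_island_measure_def)
  show "emeasure \<nu> M_seq \<noteq> \<infinity>" for i :: nat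
    using assms(1) prob_space.emeasure_space_1[of \<nu>] by (auto simp: is_island_measure_def)
qed (use Int_stable_islands islands_Pow M_in_islands in auto)

lemma ex_island_measure: "\<exists>\<nu>. is_island_measure \<nu>"
proof -
  define F :: "nat \<Rightarrow> nat measure" where "F = (\<lambda>i. uniform_count_measure {1..max 1 i})"
  define P where "P = PiM {1..} F"
  interpret pp: product_prob_space F "{1..}"
    unfolding product_prob_space_def product_prob_space_axioms_def product_sigma_finite_def
    by (auto simp: F_def intro!: prob_space_uniform_count_measure prob_space_imp_sigma_finite)
  have sF: "space (F i) = {1..max 1 i}" "sets (F i) = Pow {1..max 1 i}" for i
    by (auto simp: F_def space_uniform_count_measure sets_uniform_count_measure)
  have spP: "space P = M_seq"
    unfolding P_def space_PiM M_seq_def by (intro PiE_cong) (auto simp: sF)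
  have isl: "island k a = {b \<in> space P. \<forall>i\<in>{1..k}. b i \<in> {a i}}" for k a
    by (auto simp: island_def spP)
  have setsP: "sets P = sigma_sets M_seq {{f \<in> M_seq. f i \<in> A} | i A. i \<in> {1..} \<and> A \<in> sets (F i)}"
    unfolding P_def sets_PiM_single using spP by (simp add: P_def space_PiM)
  have F_sets: "{a i} \<in> sets (F i)" if "a \<in> M_seq" "1 \<le> i" for a i
    using M_range[OF that] by (auto simp: sF)
  have isl_P: "island k a \<in> sets P" if "a \<in> M_seq" for k a
  proof -
    have "{b \<in> space P. b i \<in> {a i}} \<in> sets P" if "1 \<le> i" for i
      unfolding setsP spP using F_sets[OF \<open>a \<in> M_seq\<close> that] that
      by (intro sigma_sets.Basic CollectI exI[of _ i] exI[of _ "{a i}"]) auto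
    then show ?thesis unfolding isl
      by (intro sets.sets_Collect_finite_All) auto
  qed
  have opn: "pm_open M_seq d_M {f \<in> M_seq. f i \<in> A}" if "1 \<le> i" for i A
    unfolding pm_open_def
  proof (intro conjI ballI)
    fix b assume b: "b \<in> {f \<in> M_seq. f i \<in> A}"
    then have "pm_ball M_seq d_M b (1 / 2 ^ i) \<subseteq> {f \<in> M_seq. f i \<in> A}"
      using that by (subst ball_M) (auto simp: island_def)
    then show "\<exists>r>0. pm_ball M_seq d_M b r \<subseteq> {f \<in> M_seq. f i \<in> A}"
      by (intro exI[of _ "1 / 2 ^ i"]) auto
  qed auto
  have sets_eq: "sets P = pm_borel_sets M_seq d_M"
  proof
    show "sets P \<subseteq> pm_borel_sets M_seq d_M"
      unfolding setsP pm_borel_sets_def using opn by (intro sigma_sets_mono') auto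
    have "islands \<subseteq> sets P" using isl_P by (auto simp: islands_def)
    then show "pm_borel_sets M_seq d_M \<subseteq> sets P"
      unfolding borel_M_eq using sets.sigma_sets_subset[of islands P] spP by simp
  qed
  have em: "emeasure P (island k a) = ennreal (1 / fact k)" if a: "a \<in> M_seq" for k a
  proof -
    have "emeasure P (island k a) = (\<Prod>i\<in>{1..k}. emeasure (F i) {a i})"
      unfolding isl P_def using F_sets[OF a] by (intro pp.emeasure_PiM_Collect) auto
    also have "\<dots> = (\<Prod>i\<in>{1..k}. ennreal (1 / real i))"
    proof (rule prod.cong)
      fix i assume i: "i \<in> {1..k}"
      then have "{a i} \<subseteq> {1..max 1 i}" using M_range[OF a, of i] by auto
      then show "emeasure (F i) {a i} = ennreal (1 / real i)"
        unfolding F_def using i by (subst emeasure_uniform_count_measure) (auto simp: max_def)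
    qed simp
    also have "\<dots> = ennreal (\<Prod>i\<in>{1..k}. 1 / real i)"
      by (rule prod_ennreal) auto
    also have "(\<Prod>i\<in>{1..k}. 1 / real i) = 1 / fact k"
      by (simp add: prod_dividef fact_prod)
    finally show ?thesis .
  qed
  have "prob_space P" unfolding P_def by (rule pp.P.prob_space_axioms)
  then have "is_island_measure P"
    using spP sets_eq em by (auto simp: is_island_measure_def)
  then show ?thesis by blast
qed

lemma ex1_island_measure: "\<exists>!\<nu>. is_island_measure \<nu>"
  using ex_island_measure island_measure_unique by blast

lemma is_island_measure_nu: "is_island_measure nu"
  unfolding nu_def by (rule theI'[OF ex1_island_measure])

end

theory Submission
  imports Defs
begin

text \<open>Two points \<open>(x, u)\<close> and \<open>(y, u)\<close> are at distance zero as soon as \<open>u \<in> I_dyadic k\<close> for some \<open>k\<close> up to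
  which \<open>x\<close> and \<open>y\<close> agree. Such a height \<open>u\<close> is called a gate below. The distance \<open>d_p\<close> is the length
  of the shortest vertical detour through a gate, and a Lipschitz function cannot tell the two sides
  of a gate apart.

  Existence of the derivative. On each fibre \<open>{x} \<times> I\<close> the function \<open>f\<close> is Lipschitz in the usual
  sense, hence differentiable at almost every height (\<open>lipschitz_AE_differentiable\<close>). Suppose that
  the derivative at \<open>(x, t)\<close> is close to \<open>q\<close>, and consider the set of all points near which
  \<open>f\<close> is affine with slope \<open>q\<close> up to an error \<open>\<eta>\<close> times the increment, on a vertical window of
  radius \<open>R\<close> (\<open>near_linear\<close>). For almost every \<open>(x, t)\<close> in this set, the points of the set at
  the \<^emph>\<open>same height\<close> \<open>t\<close> have density one at \<open>x\<close> along the islands shrinking to \<open>x\<close>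
  (\<open>AE_island_density\<close>). For a point \<open>(y, s)\<close> over such a \<open>y\<close>, compare \<open>f (x, t)\<close> with
  \<open>f (x, u) = f (y, u)\<close>, then with \<open>f (y, t)\<close>, then with \<open>f (y, s)\<close>, where \<open>u\<close> is an almost optimal
  gate. Each step has slope \<open>q\<close> up to an error of order \<open>\<eta> * d_p (y, s) (x, t)\<close>
  (\<open>gate_estimate\<close>). The exceptional \<open>y\<close> fill a small part of each small island around \<open>x\<close>;
  as every horizontal slice of a ball is such an island, the exceptional points fill a small part of
  each small ball by Fubini (\<open>emeasure_ball_fraction_le\<close>). Comparing at equal height means
  that the density theorem is needed only on the factor \<open>M\<close>, where islands are nested or disjoint, and not
  for the balls of the product, whose measure is far from doubling.

  Uniqueness. Two derivatives can differ only if most of the mass of small balls lies at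
  heights much closer to \<open>t\<close> than the radius. This is excluded by moving such points vertically by half the
  radius, in the direction of their gate (\<open>emeasure_ball_le_outer\<close>).

  Completeness holds since \<open>d_p\<close> induces a topology coarser than the compact product topology.\<close>

section \<open>Comparison of measures by disjoint covers\<close>

text \<open>This is how a covering theorem turns into an inequality between measures: \<open>A\<close> is the disjoint
  subfamily that the covering theorem selects. It serves for intervals in \<open>\<real>\<close> and for islands in \<open>M\<close>.\<close>

lemma emeasure_le_disjoint_cover:
  fixes c :: ennreal
  assumes sets: "sets M = sets N"
    and E: "E \<in> sets M" and V: "V \<in> sets N"
    and C: "countable C" "disjoint_family_on A C"
    and A: "\<And>i. i \<in> C \<Longrightarrow> A i \<in> sets M" "\<And>i. i \<in> C \<Longrightarrow> A i \<subseteq> V"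
    and le: "\<And>i. i \<in> C \<Longrightarrow> emeasure M (A i) \<le> c * emeasure N (A i)"
    and null: "E - (\<Union>i\<in>C. A i) \<in> null_sets M"
  shows "emeasure M E \<le> c * emeasure N V"
proof -
  let ?U = "\<Union>i\<in>C. A i"
  have U: "?U \<in> sets M" using C A by (intro sets.countable_UN') auto
  have "emeasure M E \<le> emeasure M (?U \<union> (E - ?U))"
    using U E by (intro emeasure_mono) auto
  also have "\<dots> = emeasure M ?U"
    using U null by (rule emeasure_Un_null_set)
  also have "\<dots> = (\<integral>\<^sup>+i. emeasure M (A i) \<partial>count_space C)"
    using C A by (intro emeasure_UN_countable) auto
  also have "\<dots> \<le> (\<integral>\<^sup>+i. c * emeasure N (A i) \<partial>count_space C)"
    using le by (intro nn_integral_mono) auto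
  also have "\<dots> = c * (\<integral>\<^sup>+i. emeasure N (A i) \<partial>count_space C)"
    by (rule nn_integral_cmult) auto
  also have "(\<integral>\<^sup>+i. emeasure N (A i) \<partial>count_space C) = emeasure N ?U"
    using C A sets by (intro emeasure_UN_countable[symmetric]) auto
  also have "\<dots> \<le> emeasure N V"
    using A V by (intro emeasure_mono) auto
  finally show ?thesis by (simp add: mult_left_mono)
qed

section \<open>Lipschitz functions on the line\<close>

text \<open>By outer regularity of \<open>N\<close> it suffices to use intervals inside an open neighbourhood of \<open>E\<close> with
  almost no additional \<open>N\<close>-mass, and Vitali's theorem makes them disjoint. Vitali leaves out a Lebesgue
  null set, whence the absolute continuity of \<open>M\<close>. The set \<open>G\<close> provides the finiteness that regularity needs.\<close>

lemma Vitali_measure_comparison: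
  fixes M N :: "real measure" and c :: real
  assumes sets: "sets M = sets borel" "sets N = sets borel"
    and ac: "\<And>A. A \<in> null_sets lborel \<Longrightarrow> A \<in> null_sets M"
    and E: "E \<in> sets borel" and G: "open G" "E \<subseteq> G" and fin: "emeasure N G < \<infinity>"
    and c: "0 < c"
    and fine: "\<And>x \<delta>. x \<in> E \<Longrightarrow> 0 < \<delta> \<Longrightarrow>
       \<exists>a b. a < b \<and> b - a < \<delta> \<and> x \<in> {a..b} \<and> emeasure M {a..b} \<le> ennreal c * emeasure N {a..b}"
  shows "emeasure M E \<le> ennreal c * emeasure N E"
proof (rule ennreal_le_epsilon)
  fix e :: real assume e: "0 < e"
  define N' where "N' = density N (indicator G)"
  have Gb: "G \<in> sets N" using G sets by auto
  have N'A: "emeasure N' A = emeasure N (G \<inter> A)" if "A \<in> sets borel" for A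
    using that sets Gb unfolding N'_def
    by (subst emeasure_density) (auto simp: nn_integral_indicator simp flip: indicator_inter_arith)
  have sN': "sets N' = sets borel" using sets by (simp add: N'_def)
  have spN: "space N = UNIV" "space N' = UNIV"
    using sets_eq_imp_space_eq[OF sets(2)] sets_eq_imp_space_eq[OF sN'] by simp_all
  have EN: "emeasure N' E = emeasure N E"
    using N'A[OF E] G by (simp add: Int_absorb1)
  have "emeasure N' (space N') < \<infinity>" using N'A[of UNIV] fin by (simp add: spN)
  then have finE: "emeasure N' E < \<infinity>" 
    by (rule le_less_trans[OF emeasure_space])
  have "emeasure N' E = (INF U \<in> {U. E \<subseteq> U \<and> open U}. emeasure N' U)"
    using outer_regular[of N' E] sN' E \<open>emeasure N' (space N') < \<infinity>\<close> by auto
  moreover have "emeasure N' E < emeasure N' E + ennreal (e / c)"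
    using e c finE by (cases "emeasure N' E") (auto simp flip: ennreal_plus intro!: ennreal_lessI add_nonneg_pos)
  ultimately obtain U where U: "E \<subseteq> U" "open U" "emeasure N' U < emeasure N' E + ennreal (e / c)"
    by (auto simp: INF_less_iff)
  define V where "V = U \<inter> G"
  have V: "E \<subseteq> V" "open V" using U G by (auto simp: V_def)
  define K where "K = {(a, b). a < b \<and> {a..b} \<subseteq> V \<and> emeasure M {a..b} \<le> ennreal c * emeasure N {a..b}}"
  \<comment> \<open>Vitali's theorem concerns balls; an interval is the ball with centre \<open>m\<close> and radius \<open>r\<close>.\<close>
  define m where "m = (\<lambda>(a, b). (a + b) / 2 :: real)"
  define r where "r = (\<lambda>(a, b). (b - a) / 2 :: real)"
  have cball: "cball (m i) (r i) = {fst i..snd i}" for i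
    by (cases i) (auto simp: cball_eq_atLeastAtMost m_def r_def field_simps)
  obtain C where C: "countable C" "C \<subseteq> K"
     "pairwise (\<lambda>i j. disjnt (cball (m i) (r i)) (cball (m j) (r j))) C"
     "negligible (E - (\<Union>i \<in> C. cball (m i) (r i)))"
  proof (rule Vitali_covering_theorem_cballs[of K r E m])
    show "0 < r i" if "i \<in> K" for i using that by (auto simp: K_def r_def)
    show "\<exists>i. i \<in> K \<and> x \<in> cball (m i) (r i) \<and> r i < d" if x: "x \<in> E" and d: "0 < d" for x d
    proof -
      obtain \<rho> where \<rho>: "0 < \<rho>" "ball x \<rho> \<subseteq> V"
        using V x by (meson open_contains_ball subsetD)
      obtain a b where ab: "a < b" "b - a < min d \<rho>" "x \<in> {a..b}" "emeasure M {a..b} \<le> ennreal c * emeasure N {a..b}"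
        using fine[OF x, of "min d \<rho>"] d \<rho> by auto
      have "{a..b} \<subseteq> ball x \<rho>" using ab by (auto simp: dist_real_def)
      then have "(a, b) \<in> K" using ab \<rho> by (auto simp: K_def)
      moreover have "r (a, b) < d" using ab by (auto simp: r_def)
      ultimately show ?thesis using ab(3) by (intro exI[of _ "(a, b)"]) (simp add: cball)
    qed
  qed blast
  have CK: "{fst i..snd i} \<subseteq> V" "emeasure M {fst i..snd i} \<le> ennreal c * emeasure N {fst i..snd i}"
    if "i \<in> C" for i
    using subsetD[OF C(2) that] unfolding K_def by (cases i; simp)+
  have "emeasure M E \<le> ennreal c * emeasure N V"
  proof (rule emeasure_le_disjoint_cover[where A = "\<lambda>i. {fst i..snd i}" and C = C])
    show "disjoint_family_on (\<lambda>i. {fst i..snd i}) C"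
      using C(3) unfolding cball disjoint_family_on_def pairwise_def disjnt_def by blast
    have "E - (\<Union>i\<in>C. {fst i..snd i}) \<in> sets borel"
      using E C(1) by (intro sets.Diff sets.countable_UN') auto
    moreover have "E - (\<Union>i\<in>C. {fst i..snd i}) \<in> null_sets lebesgue"
      using C(4) by (simp add: cball negligible_iff_null_sets)
    ultimately have "E - (\<Union>i\<in>C. {fst i..snd i}) \<in> null_sets lborel"
      by (auto simp: null_sets_def)
    then show "E - (\<Union>i\<in>C. {fst i..snd i}) \<in> null_sets M" by (rule ac)
  qed (use sets E V(2) C(1) CK in auto)
  also have "emeasure N V = emeasure N' U"
    using N'A[of U] U by (simp add: V_def Int_commute)
  also have "ennreal c * \<dots> \<le> ennreal c * (emeasure N E + ennreal (e / c))"
    using U EN by (intro mult_left_mono) auto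
  also have "\<dots> = ennreal c * emeasure N E + ennreal e"
    using c e by (simp add: distrib_left flip: ennreal_mult)
  finally show "emeasure M E \<le> ennreal c * emeasure N E + ennreal e" .
qed

text \<open>The limit is the supremum of all eventual lower bounds. Rational thresholds suffice, so almost
  everywhere convergence reduces to countably many null sets.\<close>

lemma tendsto_if_no_oscillation:
  fixes s :: "'a \<Rightarrow> real"
  assumes F: "F \<noteq> bot" and B: "\<forall>\<^sub>F y in F. \<bar>s y\<bar> \<le> B"
    and no: "\<And>p q. p \<in> \<rat> \<Longrightarrow> q \<in> \<rat> \<Longrightarrow> p < q \<Longrightarrow>
      \<not> ((\<exists>\<^sub>F y in F. s y < p) \<and> (\<exists>\<^sub>F y in F. q < s y))"
  shows "\<exists>l. (s \<longlongrightarrow> l) F"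
proof -
  define S where "S = {p. \<forall>\<^sub>F y in F. p \<le> s y}"
  have S_ne: "- B \<in> S" unfolding S_def mem_Collect_eq using B by (rule eventually_mono) auto
  have S_le: "p \<le> B" if "p \<in> S" for p
  proof -
    have "\<forall>\<^sub>F y in F. p \<le> B"
      using B that unfolding S_def mem_Collect_eq by eventually_elim auto
    then show ?thesis using F by (simp add: eventually_const)
  qed
  have bdd: "bdd_above S" using S_le by (rule bdd_aboveI)
  have "(s \<longlongrightarrow> Sup S) F"
  proof (rule order_tendstoI)
    fix a assume "a < Sup S"
    then obtain p where p: "p \<in> S" "a < p" using S_ne bdd less_cSup_iff[of S a] by blast
    then show "\<forall>\<^sub>F y in F. a < s y"
      unfolding S_def mem_Collect_eq by (auto elim: eventually_mono)
  next
    fix a assume "Sup S < a"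
    then obtain q where q: "q \<in> \<rat>" "Sup S < q" "q < a" using Rats_dense_in_real by blast
    then obtain p where p: "p \<in> \<rat>" "Sup S < p" "p < q" using Rats_dense_in_real by blast
    have "p \<notin> S" using p(2) cSup_upper[OF _ bdd, of p] by auto
    then have "\<exists>\<^sub>F y in F. s y < p"
      by (simp add: S_def frequently_def not_less)
    then have "\<forall>\<^sub>F y in F. s y \<le> q"
      using no[OF p(1) q(1) p(3)] by (simp add: frequently_def not_less)
    then show "\<forall>\<^sub>F y in F. s y < a"
      by (rule eventually_mono) (use q in auto)
  qed
  then show ?thesis ..
qed

lemma borel_frequently_at:
  fixes P :: "real \<Rightarrow> real \<Rightarrow> bool"
  assumes "\<And>y. open {x. P x y}"
  shows "{x. \<exists>\<^sub>F y in at x. P x y} \<in> sets borel"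
proof -
  define W where "W = (\<lambda>n::nat. \<Union>y. {x. y \<noteq> x \<and> dist y x < inverse (real (Suc n)) \<and> P x y})"
  have "open (W n)" for n
    unfolding W_def
    by (intro open_UN ballI open_Collect_conj open_Collect_neq open_Collect_less assms continuous_intros)
  then have "(\<Inter>n. W n) \<in> sets borel" by auto
  moreover have "{x. \<exists>\<^sub>F y in at x. P x y} = (\<Inter>n. W n)"
  proof (intro equalityI subsetI)
    fix x assume "x \<in> {x. \<exists>\<^sub>F y in at x. P x y}"
    then have "\<And>d. d > 0 \<Longrightarrow> \<exists>y. y \<noteq> x \<and> dist y x < d \<and> P x y"
      unfolding frequently_def eventually_at by auto
    then show "x \<in> (\<Inter>n. W n)" by (auto simp: W_def)
  next
    fix x assume x: "x \<in> (\<Inter>n. W n)"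
    have "\<exists>y. y \<noteq> x \<and> dist y x < d \<and> P x y" if d: "d > 0" for d
    proof -
      obtain n where n: "inverse (real (Suc n)) < d" using reals_Archimedean[OF d] by auto
      from x have "x \<in> W n" by blast
      then show ?thesis using n unfolding W_def by force
    qed
    then show "x \<in> {x. \<exists>\<^sub>F y in at x. P x y}"
      unfolding frequently_def eventually_at by auto
  qed
  ultimately show ?thesis by simp
qed

text \<open>Lebesgue's argument for the differentiability of monotone functions. Let \<open>M A\<close> be the Lebesgue
  measure of \<open>g ` A\<close>, so that intervals of slope below \<open>p\<close> satisfy \<open>M I \<le> p |I|\<close> and intervals of slope above
  \<open>q\<close> satisfy \<open>|I| \<le> M I / q\<close>. Near each point of the oscillation set \<open>E\<close> both kinds are arbitrarily
  short, hence \<open>|E| \<le> M E / q \<le> (p / q) |E|\<close> and \<open>|E| = 0\<close>. The lower bound for the increments of \<open>g\<close>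
  makes \<open>g\<close> a homeomorphism, which turns \<open>M\<close> into an image measure; the upper bound makes \<open>M\<close> absolutely
  continuous.\<close>

lemma oscillation_set_null:
  fixes g :: "real \<Rightarrow> real" and p q K :: real
  assumes lower: "\<And>x y. x \<le> y \<Longrightarrow> y - x \<le> g y - g x"
    and upper: "\<And>x y. x \<le> y \<Longrightarrow> g y - g x \<le> K * (y - x)"
    and "p < q"
  defines "slope \<equiv> (\<lambda>x y. (g y - g x) / (y - x))"
  shows "{x. (\<exists>\<^sub>F y in at x. slope x y < p) \<and> (\<exists>\<^sub>F y in at x. q < slope x y)} \<in> null_sets lborel"
    (is "?E \<in> _")
proof (cases "0 < p")
  case False
  have slope1: "1 \<le> slope x y" if "x \<noteq> y" for x y
  proof (cases "x < y")
    case True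
    then show ?thesis using lower[of x y] unfolding slope_def by (subst le_divide_eq_1_pos) auto
  next
    case False
    then have "y < x" using that by simp
    then have "1 \<le> (g x - g y) / (x - y)" using lower[of y x] by (subst le_divide_eq_1_pos) auto
    then show ?thesis unfolding slope_def by (metis minus_diff_eq minus_divide_divide)
  qed
  have "\<not> slope x y < p" if "y \<noteq> x" for x y
    using slope1[of x y] that False by simp
  then have "\<forall>\<^sub>F y in at x. \<not> slope x y < p" for x
    unfolding eventually_at_filter by (intro always_eventually) simp
  then have E: "?E = {}" unfolding frequently_def by blast
  show ?thesis by (subst E) simp
next
  case p: True
  have K: "1 \<le> K" using lower[of 0 1] upper[of 0 1] by simp
  have contg: "continuous_on UNIV g"
  proof (rule lipschitz_on_continuous_on)
    show "K-lipschitz_on UNIV g"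
    proof (rule lipschitz_onI)
      show "dist (g x) (g y) \<le> K * dist x y" for x y
        using lower[of x y] lower[of y x] upper[of x y] upper[of y x]
        by (cases "x \<le> y") (auto simp: dist_real_def abs_if algebra_simps)
    qed (use K in auto)
  qed
  have smono: "strict_mono g"
  proof (rule strict_monoI)
    show "g x < g y" if "x < y" for x y
      using lower[OF less_imp_le[OF that]] that by linarith
  qed
  have "surj g"
  proof -
    have "\<exists>x. g x = y" for y
    proof -
      define c where "c = \<bar>y - g 0\<bar>"
      have c: "0 \<le> c" "y - g 0 \<le> c" "g 0 - y \<le> c" by (simp_all add: c_def)
      have "0 - (-c) \<le> g 0 - g (-c)" "c - 0 \<le> g c - g 0"
        using c(1) by (intro lower; simp)+
      then have "g (-c) \<le> y" "y \<le> g c" using c by linarith+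
      moreover have "continuous_on {-c..c} g" using contg by (rule continuous_on_subset) simp
      ultimately show ?thesis using IVT'[of g "-c" y c] c(1) by auto
    qed
    then show ?thesis by (metis surjI)
  qed
  define h where "h = inv g"
  have gh: "g (h y) = y" for y using \<open>surj g\<close> by (simp add: h_def surj_f_inv_f)
  have hg: "h (g x) = x" for x using smono by (simp add: h_def strict_mono_imp_inj_on)
  have "continuous_on UNIV h"
  proof (rule lipschitz_on_continuous_on)
    show "1-lipschitz_on UNIV h"
    proof (rule lipschitz_onI)
      show "dist (h x) (h y) \<le> 1 * dist x y" for x y
        using lower[of "h x" "h y"] lower[of "h y" "h x"]
        by (cases "h x \<le> h y") (simp_all add: gh dist_real_def)
    qed auto
  qed
  then have hm [measurable]: "h \<in> borel_measurable borel"
    by (rule borel_measurable_continuous_onI)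
  define M where "M = distr lborel borel h"
  have sM: "sets M = sets borel" by (simp add: M_def)
  have h_vimage: "h -` A = g ` A" for A
    using gh hg by (auto simp: image_iff) metis
  have M_I: "emeasure M {a..b} = ennreal (g b - g a)" if "a \<le> b" for a b
  proof -
    have "h -` {a..b} = {g a..g b}"
      using strict_mono_less_eq[OF smono, of a "h _"] strict_mono_less_eq[OF smono, of "h _" b]
      by (auto simp: gh)
    then show ?thesis using that smono
      by (simp add: M_def emeasure_distr strict_mono_less_eq)
  qed
  have ac: "A \<in> null_sets M" if A: "A \<in> null_sets lborel" for A
  proof -
    have Ab: "A \<in> sets borel" using A by auto
    have "negligible A"
      using A by (simp add: negligible_iff_null_sets null_sets_completionI)
    then have "negligible (g ` A)"
    proof (rule negligible_locally_Lipschitz_image[OF order_refl])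
      show "\<exists>T B. open T \<and> x \<in> T \<and> (\<forall>y\<in>A \<inter> T. norm (g y - g x) \<le> B * norm (y - x))" for x
      proof (intro exI[of _ UNIV] exI[of _ K] conjI ballI)
        show "norm (g y - g x) \<le> K * norm (y - x)" for y
          using lower[of x y] lower[of y x] upper[of x y] upper[of y x]
          by (cases "x \<le> y") (auto simp: abs_if algebra_simps)
      qed auto
    qed
    moreover have "g ` A \<in> sets borel"
      using measurable_sets_borel[OF hm Ab] by (simp add: h_vimage)
    ultimately have "g ` A \<in> null_sets lborel"
      by (auto simp: negligible_iff_null_sets null_sets_def)
    then show ?thesis using Ab by (auto simp: null_sets_def M_def emeasure_distr h_vimage)
  qed
  have Eb: "?E \<in> sets borel"
  proof -
    \<comment> \<open>Multiplying by \<open>(y - x)\<^sup>2\<close> replaces the slopes by expressions continuous in \<open>x\<close>.\<close>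
    have s1: "slope x y < p \<longleftrightarrow> (g y - g x) * (y - x) < p * (y - x)\<^sup>2"
     and s2: "q < slope x y \<longleftrightarrow> q * (y - x)\<^sup>2 < (g y - g x) * (y - x)" if "y \<noteq> x" for x y
    proof -
      have "slope x y * (y - x)\<^sup>2 = (g y - g x) * (y - x)"
        using that by (simp add: slope_def power2_eq_square)
      moreover have "0 < (y - x)\<^sup>2" using that by simp
      ultimately show "slope x y < p \<longleftrightarrow> (g y - g x) * (y - x) < p * (y - x)\<^sup>2"
        "q < slope x y \<longleftrightarrow> q * (y - x)\<^sup>2 < (g y - g x) * (y - x)"
        by (metis mult_less_cancel_right_pos)+
    qed
    have "(\<exists>\<^sub>F y in at x. slope x y < p) \<longleftrightarrow> (\<exists>\<^sub>F y in at x. (g y - g x) * (y - x) < p * (y - x)\<^sup>2)" 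
       "(\<exists>\<^sub>F y in at x. q < slope x y) \<longleftrightarrow> (\<exists>\<^sub>F y in at x. q * (y - x)\<^sup>2 < (g y - g x) * (y - x))" for x
      by (simp_all add: frequently_def eventually_at_filter s1 s2 cong: imp_cong)
    then have "?E = {x. \<exists>\<^sub>F y in at x. (g y - g x) * (y - x) < p * (y - x)\<^sup>2} \<inter>
                {x. \<exists>\<^sub>F y in at x. q * (y - x)\<^sup>2 < (g y - g x) * (y - x)}" by auto
    also have "\<dots> \<in> sets borel"
      by (intro sets.Int borel_frequently_at open_Collect_less continuous_intros
          continuous_on_subset[OF contg]) auto
    finally show ?thesis .
  qed
  \<comment> \<open>Slopes are symmetric in the two end points, so \<open>x\<close> may be either of them.\<close>
  have interval: "\<exists>a b. a < b \<and> b - a < \<delta> \<and> x \<in> {a..b} \<and> P ((g b - g a) / (b - a))"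
    if ex: "\<exists>\<^sub>F y in at x. P (slope x y)" and "0 < \<delta>" for x \<delta> P
  proof -
    obtain y where y: "y \<noteq> x" "dist y x < \<delta>" "P (slope x y)"
      using ex \<open>0 < \<delta>\<close> unfolding frequently_def eventually_at by blast
    have "slope x y = slope y x" using y by (simp add: slope_def divide_simps) (simp add: algebra_simps)
    then show ?thesis using y
      by (intro exI[of _ "min x y"] exI[of _ "max x y"]) (auto simp: slope_def min_def max_def dist_real_def)
  qed
  have null: "?E \<inter> {-n<..<n} \<in> null_sets lborel" for n :: real
  proof (cases "0 < n")
    case True
    let ?F = "?E \<inter> {-n<..<n}"
    have Fb: "?F \<in> sets borel" using Eb by auto
    have fin: "emeasure lborel {-n<..<n} < \<infinity>" "emeasure M {-n<..<n} < \<infinity>"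
    proof -
      show "emeasure lborel {-n<..<n} < \<infinity>" using True by simp
      have "emeasure M {-n<..<n} \<le> emeasure M {-n..n}"
        by (rule emeasure_mono) (auto simp: sM)
      also have "\<dots> < \<infinity>" using True by (simp add: M_I)
      finally show "emeasure M {-n<..<n} < \<infinity>" .
    qed
    have "emeasure M ?F \<le> ennreal p * emeasure lborel ?F"
    proof (rule Vitali_measure_comparison[where G = "{-n<..<n}"])
      fix x \<delta> assume x: "x \<in> ?F" "(0::real) < \<delta>"
      then obtain a b where ab: "a < b" "b - a < \<delta>" "x \<in> {a..b}" "(g b - g a) / (b - a) < p"
        using interval[where x = x and \<delta> = \<delta> and P = "\<lambda>s. s < p"] by auto
      then have "g b - g a \<le> p * (b - a)" by (simp add: pos_divide_less_eq)
      then have "emeasure M {a..b} \<le> ennreal p * emeasure lborel {a..b}"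
        using ab p by (simp add: M_I flip: ennreal_mult)
      then show "\<exists>a b. a < b \<and> b - a < \<delta> \<and> x \<in> {a..b} \<and> emeasure M {a..b} \<le> ennreal p * emeasure lborel {a..b}"
        using ab by blast
    qed (use Fb fin sM ac p in auto)
    moreover have "emeasure lborel ?F \<le> ennreal (1 / q) * emeasure M ?F"
    proof (rule Vitali_measure_comparison[where G = "{-n<..<n}"])
      fix x \<delta> assume x: "x \<in> ?F" "(0::real) < \<delta>"
      then obtain a b where ab: "a < b" "b - a < \<delta>" "x \<in> {a..b}" "q < (g b - g a) / (b - a)"
        using interval[where x = x and \<delta> = \<delta> and P = "\<lambda>s. q < s"] by auto
      then have "q * (b - a) \<le> g b - g a" by (simp add: pos_less_divide_eq)
      then have "b - a \<le> (1 / q) * (g b - g a)" using p \<open>p < q\<close> by (simp add: field_simps)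
      then have "emeasure lborel {a..b} \<le> ennreal (1 / q) * emeasure M {a..b}"
        using ab p \<open>p < q\<close> lower[of a b] by (simp add: M_I flip: ennreal_mult)
      then show "\<exists>a b. a < b \<and> b - a < \<delta> \<and> x \<in> {a..b} \<and> emeasure lborel {a..b} \<le> ennreal (1 / q) * emeasure M {a..b}"
        using ab by blast
    qed (use Fb fin sM p \<open>p < q\<close> in auto)
    ultimately have le: "emeasure lborel ?F \<le> ennreal (1 / q) * (ennreal p * emeasure lborel ?F)"
      by (meson mult_left_mono order_trans zero_le)
    have "emeasure lborel ?F \<le> emeasure lborel {-n<..<n}"
      by (rule emeasure_mono) auto
    then have "emeasure lborel ?F < \<infinity>" using fin(1) by (rule le_less_trans)
    then obtain w where w: "0 \<le> w" "emeasure lborel ?F = ennreal w"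
      by (cases "emeasure lborel ?F") auto
    have "w \<le> (1 / q) * (p * w)"
      using le w p \<open>p < q\<close> by (simp flip: ennreal_mult)
    then have "(q - p) * w \<le> 0" using p \<open>p < q\<close> by (simp add: field_simps)
    then have "w = 0" using w \<open>p < q\<close> by (simp add: mult_le_0_iff)
    then show ?thesis using Fb w by (auto simp: null_sets_def)
  qed simp
  have "?E = (\<Union>n::nat. ?E \<inter> {-real n<..<real n})"
  proof -
    have "\<exists>n::nat. x \<in> {-real n<..<real n}" for x
      using reals_Archimedean2[of "\<bar>x\<bar>"] unfolding abs_less_iff greaterThanLessThan_iff
      by (metis minus_less_iff)
    then show ?thesis by blast
  qed
  also have "\<dots> \<in> null_sets lborel" by (intro null_sets_UN null)
  finally show ?thesis .
qed

text \<open>Adding a multiple of the identity makes \<open>f\<close> increasing with increments bounded from below, and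
  does not affect differentiability.\<close>

theorem lipschitz_AE_differentiable:
  fixes f :: "real \<Rightarrow> real"
  assumes "L-lipschitz_on UNIV f"
  shows "AE x in lborel. \<exists>l. (f has_real_derivative l) (at x)"
proof -
  have L: "0 \<le> L" "\<bar>f x - f y\<bar> \<le> L * \<bar>x - y\<bar>" for x y
    using assms lipschitz_onD[OF assms, of x y] lipschitz_on_nonneg by (auto simp: dist_real_def)
  \<comment> \<open>The summand \<open>1\<close> gives all increments slope at least 1.\<close>
  define g where "g = (\<lambda>x. f x + (L + 1) * x)"
  define slope where "slope = (\<lambda>x y. (g y - g x) / (y - x))"
  have lower: "y - x \<le> g y - g x" and upper: "g y - g x \<le> (2 * L + 1) * (y - x)" if "x \<le> y" for x y
    using L(2)[of y x] that by (auto simp: g_def algebra_simps abs_le_iff)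
  have "AE x in lborel. x \<notin> {x. (\<exists>\<^sub>F y in at x. slope x y < p) \<and> (\<exists>\<^sub>F y in at x. q < slope x y)}"
    if "p < q" for p q
    using oscillation_set_null[OF lower upper that] unfolding slope_def by (intro AE_not_in) auto
  then have "AE x in lborel. \<forall>(p, q)\<in>{(p, q). p \<in> \<rat> \<and> q \<in> \<rat> \<and> p < q}.
      x \<notin> {x. (\<exists>\<^sub>F y in at x. slope x y < p) \<and> (\<exists>\<^sub>F y in at x. q < slope x y)}"
    by (intro AE_ball_countable[THEN iffD2]) (auto intro!: countable_subset[of _ "\<rat> \<times> \<rat>"] countable_SIGMA countable_rat)
  then show ?thesis
  proof eventually_elim
    case (elim x)
    have "\<exists>l. ((\<lambda>y. slope x y) \<longlongrightarrow> l) (at x)"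
    proof (rule tendsto_if_no_oscillation)
      have "\<bar>slope x y\<bar> \<le> 2 * L + 1" if "y \<noteq> x" for y
        using lower[of x y] upper[of x y] lower[of y x] upper[of y x] that
        unfolding slope_def by (cases "x \<le> y") (auto simp: abs_le_iff divide_simps algebra_simps)
      then show "\<forall>\<^sub>F y in at x. \<bar>slope x y\<bar> \<le> 2 * L + 1" by (auto simp: eventually_at_filter)
    qed (use elim in auto)
    then obtain l where "(slope x \<longlongrightarrow> l) (at x)" by blast
    then have "(g has_real_derivative l) (at x)"
      by (simp add: has_field_derivative_iff slope_def)
    then have "((\<lambda>x. g x - (L + 1) * x) has_real_derivative (l - (L + 1))) (at x)"
      by (auto intro!: derivative_eq_intros)
    then show ?case by (auto simp: g_def)
  qed
qed

section \<open>Islands and their density points\<close>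

lemma space_nu: "space nu = M_seq"
  and sets_nu: "sets nu = pm_borel_sets M_seq d_M"
  and prob_space_nu: "prob_space nu"
  using is_island_measure_nu by (auto simp: is_island_measure_def)

lemma pm_open_M_sets: "pm_open M_seq d_M U \<Longrightarrow> U \<in> sets nu"
  by (auto simp: sets_nu pm_borel_sets_def)

lemma island_subset: "island k x \<subseteq> M_seq"
  by (auto simp: island_def)

lemma island_antimono: "k \<le> l \<Longrightarrow> island l x \<subseteq> island k x"
  by (auto simp: island_def)

lemma island_eq: "y \<in> island k x \<Longrightarrow> l \<le> k \<Longrightarrow> island l y = island l x"
  by (intro island_cong) (auto simp: island_def)

lemma island_sets: "island k x \<in> sets nu"
  by (intro pm_open_M_sets island_open)

lemma island_in_islands: "x \<in> M_seq \<Longrightarrow> island k x \<in> islands"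
proof (cases "1 \<le> k")
  case False
  then have "island k x = M_seq" by (auto simp: island_def)
  then show ?thesis using M_in_islands by simp
qed (auto simp: islands_def)

text \<open>Any property of the level-\<open>k\<close> island of a point is locally constant in the point. This makes the
  sets defined by ratios over islands measurable.\<close>

lemma pm_open_island_pred:
  "pm_open M_seq d_M {x \<in> M_seq. P (island k x)}"
  unfolding pm_open_def
proof (intro conjI ballI)
  fix x assume x: "x \<in> {x \<in> M_seq. P (island k x)}"
  then have "pm_ball M_seq d_M x (1 / 2 ^ k) \<subseteq> {x \<in> M_seq. P (island k x)}"
    using island_eq[of _ k x k] subsetD[OF island_subset[of k x]] by (subst ball_M) auto
  then show "\<exists>r>0. pm_ball M_seq d_M x r \<subseteq> {x \<in> M_seq. P (island k x)}"
    by (intro exI[of _ "1 / 2 ^ k"]) auto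
qed auto

lemma measurable_nu_coordinate: "(\<lambda>x. x i) \<in> measurable nu (count_space UNIV)"
proof (rule measurableI)
  fix A :: "nat set"
  show "(\<lambda>x. x i) -` A \<inter> space nu \<in> sets nu"
  proof (cases "i = 0")
    case True
    have und: "x i = undefined" if "x \<in> M_seq" for x :: "nat \<Rightarrow> nat"
      using that True unfolding M_seq_def by (intro PiE_arb[of x]) auto
    have "(\<lambda>x. x i) -` A \<inter> space nu = (if undefined \<in> A then space nu else {})"
    proof (cases "(undefined :: nat) \<in> A")
      case True
      then have "x i \<in> A" if "x \<in> M_seq" for x using und[OF that] by (simp only:)
      then show ?thesis using True by (auto simp: space_nu)
    next
      case False
      then have "x i \<notin> A" if "x \<in> M_seq" for x using und[OF that] by (simp only: not_False_eq_True)
      then show ?thesis using False by (auto simp: space_nu)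
    qed
    then show ?thesis by simp
  next
    case False
    have "(\<lambda>x. x i) -` A \<inter> space nu = {x \<in> M_seq. \<exists>y\<in>island i x. y i \<in> A}"
      using False island_self by (auto simp: space_nu island_def)
    then show ?thesis using pm_open_M_sets pm_open_island_pred[of "\<lambda>J. \<exists>y\<in>J. y i \<in> A" i] by simp
  qed
qed auto

text \<open>This embedding places \<open>M\<close> in the Polish space of real sequences, where finite Borel measures are
  outer regular.\<close>

definition emb :: "(nat \<Rightarrow> nat) \<Rightarrow> nat \<Rightarrow> real" where
  "emb x = (\<lambda>i. real (x i))"

lemma sets_nu_vimage_emb:
  assumes "E \<in> sets nu"
  obtains B where "B \<in> sets borel" "E = emb -` B \<inter> M_seq"
proof -
  let ?V = "vimage_algebra M_seq emb borel"
  have "island k a \<in> sets ?V" for k a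
  proof -
    have "closed {b :: nat \<Rightarrow> real. b i = real (a i)}" for i
      by (intro closed_Collect_eq continuous_on_product_coordinates continuous_on_const)
    then have "closed (\<Inter>i\<in>{1..k}. {b :: nat \<Rightarrow> real. b i = real (a i)})" by (intro closed_INT) auto
    moreover have "island k a = emb -` (\<Inter>i\<in>{1..k}. {b. b i = real (a i)}) \<inter> M_seq"
      by (auto simp: island_def emb_def)
    ultimately show ?thesis by (simp add: in_vimage_algebra borel_closed)
  qed
  then have "islands \<subseteq> sets ?V" unfolding islands_def by blast
  then have "sets nu \<subseteq> sets ?V"
    unfolding sets_nu borel_M_eq using sets.sigma_sets_subset[of islands ?V] by simp
  then have "E \<in> sets ?V" using assms by blast
  then show ?thesis using that by (auto simp: sets_vimage_algebra2)
qed

lemma open_vimage_emb: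
  assumes "open U"
  shows "pm_open M_seq d_M (emb -` U \<inter> M_seq)"
  unfolding pm_open_def
proof (intro conjI ballI)
  fix x assume x: "x \<in> emb -` U \<inter> M_seq"
  have "openin (product_topology (\<lambda>i. euclidean) UNIV) U"
    using assms by (simp add: open_fun_def)
  moreover have "emb x \<in> U" using x by simp
  ultimately have "\<exists>X. emb x \<in> Pi\<^sub>E UNIV X \<and> (\<forall>i. openin euclidean (X i)) \<and>
      finite {i. X i \<noteq> topspace euclidean} \<and> Pi\<^sub>E UNIV X \<subseteq> U"
    by (rule product_topology_open_contains_basis)
  then obtain X where X: "emb x \<in> Pi\<^sub>E UNIV X" "finite {i. X i \<noteq> UNIV}" "Pi\<^sub>E UNIV X \<subseteq> U"
    by (elim exE conjE) (simp only: topspace_euclidean)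
  from X(2) obtain k where k: "\<And>i. X i \<noteq> UNIV \<Longrightarrow> i \<le> k"
    unfolding finite_nat_set_iff_bounded_le by blast
  have "emb y \<in> U" if y: "y \<in> island k x" for y
  proof -
    have "emb y i \<in> X i" for i
    proof (cases "X i = UNIV")
      case False
      have "y i = x i"
      proof (cases "i = 0")
        case True
        have "y \<in> M_seq" "x \<in> M_seq" using x y subsetD[OF island_subset] by blast+
        then show ?thesis unfolding M_seq_def True using PiE_arb[of _ "{1..}" _ 0] by (metis atLeast_iff not_one_le_zero)
      next
        case i: False
        then show ?thesis using y k[OF False] by (auto simp: island_def)
      qed
      moreover have "emb x i \<in> X i" using X(1) by (simp add: PiE_iff)
      ultimately show ?thesis by (simp add: emb_def)
    qed simp
    then show "emb y \<in> U" using subsetD[OF X(3), of "emb y"] by (simp add: PiE_iff)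
  qed
  then have "pm_ball M_seq d_M x (1 / 2 ^ k) \<subseteq> emb -` U \<inter> M_seq"
    using x subsetD[OF island_subset[of k x]] by (subst ball_M) auto
  then show "\<exists>r>0. pm_ball M_seq d_M x r \<subseteq> emb -` U \<inter> M_seq"
    by (intro exI[of _ "1 / 2 ^ k"]) auto
qed auto

text \<open>The measure is pushed forward along \<open>emb\<close>, and the open sets that approximate from outside are pulled back.\<close>

lemma island_outer_regular:
  assumes sets: "sets N = sets nu" and fin: "finite_measure N"
    and E: "E \<in> sets nu" and \<delta>: "0 < \<delta>"
  shows "\<exists>V. pm_open M_seq d_M V \<and> E \<subseteq> V \<and> emeasure N V < emeasure N E + ennreal \<delta>"
proof -
  interpret finite_measure N by fact
  have sp: "space N = M_seq" using sets_eq_imp_space_eq[OF sets] by (simp add: space_nu)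
  have m: "emb \<in> borel_measurable N"
  proof (rule measurable_coordinatewise_then_product)
    show "(\<lambda>x. emb x i) \<in> borel_measurable N" for i
      using measurable_compose[OF measurable_nu_coordinate[of i], of "real" borel]
      by (simp add: measurable_cong_sets[OF sets refl] emb_def)
  qed
  define D where "D = distr N borel emb"
  have D: "emeasure D A = emeasure N (emb -` A \<inter> M_seq)" if "A \<in> sets borel" for A
    using that m by (simp add: D_def emeasure_distr sp)
  obtain B where B: "B \<in> sets borel" "E = emb -` B \<inter> M_seq"
    using sets_nu_vimage_emb[OF E] by blast
  have fD: "emeasure D (space D) \<noteq> \<infinity>"
    using D[of UNIV] emeasure_finite by (simp add: D_def)
  have sD: "sets D = sets borel" by (simp add: D_def)
  have "emeasure D B = (INF U \<in> {U. B \<subseteq> U \<and> open U}. emeasure D U)"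
    by (rule outer_regular[OF sD fD B(1)])
  moreover have "emeasure D B = emeasure N E" using D[OF B(1)] B(2) by simp
  moreover have "emeasure N E < emeasure N E + ennreal \<delta>"
    using \<delta> emeasure_finite[of E] by (cases "emeasure N E") (auto simp flip: ennreal_plus intro!: ennreal_lessI)
  ultimately have "(INF U \<in> {U. B \<subseteq> U \<and> open U}. emeasure D U) < emeasure N E + ennreal \<delta>" by simp
  then obtain U where U: "B \<subseteq> U" "open U" "emeasure D U < emeasure N E + ennreal \<delta>"
    by (auto simp: INF_less_iff)
  show ?thesis
  proof (intro exI conjI)
    show "pm_open M_seq d_M (emb -` U \<inter> M_seq)" using U by (intro open_vimage_emb)
    show "E \<subseteq> emb -` U \<inter> M_seq" using U B by auto
    show "emeasure N (emb -` U \<inter> M_seq) < emeasure N E + ennreal \<delta>" using U D[of U] by simp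
  qed
qed

text \<open>The Lebesgue density theorem for islands. If the complement of \<open>A\<close> fills more than a
  fraction \<open>\<epsilon>\<close> of arbitrarily small islands around each point of \<open>E \<subseteq> A\<close>, choose for each point the largest such
  island inside an open \<open>V \<supseteq> E\<close> with \<open>\<nu> (V - A) < \<epsilon> e\<close>. Since islands are nested or disjoint, the chosen ones
  are disjoint, and \<open>\<nu> E \<le> \<nu> (V - A) / \<epsilon> < e\<close>.\<close>

theorem island_density:
  assumes A: "A \<in> sets nu"
  shows "AE x in nu. x \<in> A \<longrightarrow> (\<forall>\<epsilon>>0. \<forall>\<^sub>F k in sequentially.
           emeasure nu (island k x - A) \<le> ennreal \<epsilon> * emeasure nu (island k x))"
proof -
  interpret prob_space nu by (rule prob_space_nu)
  define bad where "bad = (\<lambda>\<epsilon> J. ennreal \<epsilon> * emeasure nu J < emeasure nu (J - A))"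
  define E where "E = (\<lambda>\<epsilon>. {x \<in> A. \<forall>n. \<exists>k\<ge>n. bad \<epsilon> (island k x)})"
  have null: "E \<epsilon> \<in> null_sets nu" if \<epsilon>: "0 < \<epsilon>" for \<epsilon>
  proof -
    have "A \<subseteq> M_seq" using sets.sets_into_space[OF A] by (simp add: space_nu)
    then have "E \<epsilon> = A \<inter> (\<Inter>n. \<Union>k\<in>{n..}. {x \<in> M_seq. bad \<epsilon> (island k x)})"
      by (auto simp: E_def)
    also have "\<dots> \<in> sets nu"
      using A pm_open_M_sets[OF pm_open_island_pred[of "bad \<epsilon>"]]
      by (intro sets.Int[OF A] sets.countable_INT' sets.countable_UN') auto
    finally have Es: "E \<epsilon> \<in> sets nu" .
    \<comment> \<open>\<open>N B = \<nu> (B - A)\<close>, which vanishes on \<open>E\<close>.\<close>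
    define N where "N = density nu (indicator (M_seq - A))"
    have sN: "sets N = sets nu" by (simp add: N_def)
    have Mset: "M_seq - A \<in> sets nu" using A sets.top[of nu] by (auto simp: space_nu)
    have N: "emeasure N B = emeasure nu (B - A)" if B: "B \<in> sets nu" for B
    proof -
      have "B \<subseteq> M_seq" using sets.sets_into_space[OF B] by (simp add: space_nu)
      then have "(M_seq - A) \<inter> B = B - A" by auto
      then show ?thesis
        using A B Mset unfolding N_def
        by (subst emeasure_density) (auto simp flip: indicator_inter_arith)
    qed
    have finN: "finite_measure N"
    proof
      show "emeasure N (space N) \<noteq> \<infinity>" using N[of M_seq] sets.top[of nu] by (simp add: N_def space_nu)
    qed
    have le: "emeasure nu (E \<epsilon>) \<le> ennreal e" if e: "0 < e" for e
    proof -
      have "emeasure N (E \<epsilon>) = 0" using N[OF Es] by (simp add: E_def Diff_eq_empty_iff[THEN iffD2])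
      then obtain V where V: "pm_open M_seq d_M V" "E \<epsilon> \<subseteq> V" "emeasure N V < ennreal (\<epsilon> * e)"
        using island_outer_regular[OF sN finN Es, of "\<epsilon> * e"] \<epsilon> e by auto
      define ok where "ok = (\<lambda>J. J \<subseteq> V \<and> bad \<epsilon> J)"
      have ex: "\<exists>k. ok (island k x)" if x: "x \<in> E \<epsilon>" for x
      proof -
        obtain r where r: "0 < r" "pm_ball M_seq d_M x r \<subseteq> V"
          using V(1,2) x unfolding pm_open_def by blast
        have xM: "x \<in> M_seq" using x \<open>A \<subseteq> M_seq\<close> by (auto simp: E_def)
        obtain n where n: "(1/2) ^ n < r" using real_arch_pow_inv[of r "1/2"] r by auto
        have "island n x \<subseteq> V"
          using n r by (subst ball_M[OF xM, symmetric]) (auto simp: pm_ball_def power_divide)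
        moreover obtain k where k: "n \<le> k" "bad \<epsilon> (island k x)" using x by (auto simp: E_def)
        ultimately show ?thesis using island_antimono[OF k(1), of x] by (auto simp: ok_def)
      qed
      \<comment> \<open>The least admissible level gives the largest admissible island.\<close>
      define \<kappa> where "\<kappa> = (\<lambda>x. LEAST k. ok (island k x))"
      have \<kappa>: "ok (island (\<kappa> x) x)" if "x \<in> E \<epsilon>" for x
        using ex[OF that] unfolding \<kappa>_def by (rule LeastI_ex)
      define C where "C = (\<lambda>x. island (\<kappa> x) x) ` E \<epsilon>"
      have eq: "island (\<kappa> x) x = island (\<kappa> y) y"
        if "x \<in> E \<epsilon>" "y \<in> E \<epsilon>" "z \<in> island (\<kappa> x) x" "z \<in> island (\<kappa> y) y" "\<kappa> x \<le> \<kappa> y" for x y z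
      proof -
        have "island (\<kappa> x) y = island (\<kappa> x) x"
          using island_eq[OF that(3) order_refl] island_eq[OF that(4) that(5)] by simp
        then have "\<kappa> y \<le> \<kappa> x" using \<kappa>[OF that(1)] by (simp add: Least_le \<kappa>_def)
        then show ?thesis using that(5) \<open>island (\<kappa> x) y = island (\<kappa> x) x\<close> by simp
      qed
      have "emeasure nu (E \<epsilon>) \<le> ennreal (1 / \<epsilon>) * emeasure N V"
      proof (rule emeasure_le_disjoint_cover[where A = "\<lambda>J. J" and C = C])
        show "countable C"
          using island_in_islands \<open>A \<subseteq> M_seq\<close> by (intro countable_subset[OF _ countable_islands]) (auto simp: C_def E_def)
        show "disjoint_family_on (\<lambda>J. J) C"
          unfolding disjoint_family_on_def C_def using eq
          by (smt (verit, best) disjoint_iff imageE linorder_le_cases)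
        show "emeasure nu J \<le> ennreal (1 / \<epsilon>) * emeasure N J" if J: "J \<in> C" for J
        proof -
          have Js: "J \<in> sets nu" using J island_sets by (auto simp: C_def)
          have "ok J" using J \<kappa> by (auto simp: C_def)
          then have "ennreal \<epsilon> * emeasure nu J \<le> emeasure N J" using N[OF Js] by (auto simp: ok_def bad_def)
          then have "ennreal (1 / \<epsilon>) * (ennreal \<epsilon> * emeasure nu J) \<le> ennreal (1 / \<epsilon>) * emeasure N J"
            by (rule mult_left_mono) simp
          then show ?thesis using \<epsilon> by (simp add: mult.assoc[symmetric] flip: ennreal_mult)
        qed
        have empty: "E \<epsilon> - (\<Union>J\<in>C. J) = {}" using island_self \<open>A \<subseteq> M_seq\<close> by (force simp: C_def E_def)
        show "E \<epsilon> - (\<Union>J\<in>C. J) \<in> null_sets nu" by (subst empty) simp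
        show "J \<subseteq> V" if "J \<in> C" for J using that \<kappa> by (auto simp: C_def ok_def)
        show "J \<in> sets nu" if "J \<in> C" for J using that island_sets by (auto simp: C_def)
      qed (use Es V pm_open_M_sets sN in auto)
      also have "\<dots> \<le> ennreal (1 / \<epsilon>) * ennreal (\<epsilon> * e)" using V(3) by (intro mult_left_mono) auto
      also have "\<dots> = ennreal e" using \<epsilon> e by (simp flip: ennreal_mult)
      finally show ?thesis .
    qed
    have "emeasure nu (E \<epsilon>) \<le> 0" 
      by (rule ennreal_le_epsilon) (use le in auto)
    then show ?thesis using Es by (auto simp: null_sets_def)
  qed
  have "AE x in nu. \<forall>m::nat. x \<notin> E (inverse (real (Suc m)))"
    unfolding AE_all_countable by (intro allI AE_not_in null) simp
  then show ?thesis
  proof (eventually_elim, intro impI allI)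
    fix x and \<epsilon> :: real
    assume x: "\<forall>m::nat. x \<notin> E (inverse (real (Suc m)))" "x \<in> A" and "0 < \<epsilon>"
    then obtain m where m: "inverse (real (Suc m)) < \<epsilon>" using reals_Archimedean by blast
    from x obtain n where n: "\<And>k. n \<le> k \<Longrightarrow> \<not> bad (inverse (real (Suc m))) (island k x)"
      unfolding E_def by blast
    show "\<forall>\<^sub>F k in sequentially. emeasure nu (island k x - A) \<le> ennreal \<epsilon> * emeasure nu (island k x)"
      using eventually_ge_at_top[of n]
    proof eventually_elim
      case (elim k)
      have "emeasure nu (island k x - A) \<le> ennreal (inverse (real (Suc m))) * emeasure nu (island k x)"
        using n[OF elim] by (simp add: bad_def not_less)
      also have "\<dots> \<le> ennreal \<epsilon> * emeasure nu (island k x)"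
        using m by (intro mult_right_mono ennreal_leI) auto
      finally show ?case .
    qed
  qed
qed

section \<open>The pseudometric space\<close>

lemma d_M_less_iff: "x \<in> M_seq \<Longrightarrow> y \<in> M_seq \<Longrightarrow> d_M x y < 1 / 2 ^ k \<longleftrightarrow> y \<in> island k x"
  using ball_M[of x k] by (auto simp: pm_ball_def)

lemma I_dyadic_subset: "u \<in> I_dyadic k \<Longrightarrow> u \<in> {0..1}"
  by (auto simp: I_dyadic_def)

lemma I_dyadic_approx:
  assumes "t \<in> {0..1}"
  obtains u where "u \<in> I_dyadic k" "\<bar>t - u\<bar> < 1 / 2 ^ k"
proof
  let ?n = "\<lfloor>t * 2 ^ k\<rfloor>"
  have "t * 2 ^ k \<le> 2 ^ k" using assms mult_right_mono[of t 1 "2 ^ k"] by simp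
  then have "?n \<le> 2 ^ k" by (metis floor_mono floor_numeral_power)
  moreover have "0 \<le> ?n" using assms by simp
  ultimately show "of_int ?n / 2 ^ k \<in> I_dyadic k" by (auto simp: I_dyadic_def)
  have "\<bar>t * 2 ^ k - of_int ?n\<bar> < 1" by linarith
  then have "\<bar>(t * 2 ^ k - of_int ?n) / 2 ^ k\<bar> < 1 / 2 ^ k" 
    by (simp add: abs_divide divide_strict_right_mono)
  then show "\<bar>t - of_int ?n / 2 ^ k\<bar> < 1 / 2 ^ k" by (simp add: diff_divide_distrib)
qed

text \<open>All metric properties below are derived from this description by gates; it replaces the infimum
  in the definition.\<close>

lemma d_p_less_iff:
  assumes x: "x \<in> M_seq" and y: "y \<in> M_seq"
  shows "d_p (x, t) (y, s) < r \<longleftrightarrow>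
    (\<exists>k. \<exists>u\<in>I_dyadic k. y \<in> island k x \<and> \<bar>t - u\<bar> + \<bar>u - s\<bar> < r)"
proof -
  let ?S = "{\<bar>t - u\<bar> + \<bar>u - s\<bar> | u. \<exists>k. u \<in> I_dyadic k \<and> d_M x y < 1 / 2 ^ k}"
  have "0 \<in> I_dyadic 0" by (auto simp: I_dyadic_def)
  moreover have "d_M x y < 1 / 2 ^ 0"
    using d_M_less_iff[OF x y, of 0] y by (simp add: island_def)
  ultimately have "?S \<noteq> {}" by blast
  moreover have "bdd_below ?S" by (rule bdd_belowI[of _ 0]) auto
  ultimately have "Inf ?S < r \<longleftrightarrow> (\<exists>z\<in>?S. z < r)" by (rule cInf_less_iff)
  then show ?thesis
    unfolding d_p_def prod.case by (auto simp: d_M_less_iff[OF x y])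
qed

lemma d_p_ge:
  assumes "x \<in> M_seq" "y \<in> M_seq"
  shows "\<bar>t - s\<bar> \<le> d_p (x, t) (y, s)"
proof (rule ccontr)
  assume "\<not> ?thesis"
  then obtain u where "\<bar>t - u\<bar> + \<bar>u - s\<bar> < \<bar>t - s\<bar>"
    using d_p_less_iff[OF assms, of t s "\<bar>t - s\<bar>"] by auto
  then show False by linarith
qed

lemma d_p_nonneg: "x \<in> M_seq \<Longrightarrow> y \<in> M_seq \<Longrightarrow> 0 \<le> d_p (x, t) (y, s)"
  using d_p_ge[of x y t s] by linarith

lemma island_sym: "x \<in> M_seq \<Longrightarrow> y \<in> island k x \<longleftrightarrow> x \<in> island k y \<and> y \<in> M_seq"
  by (auto simp: island_def)

lemma d_p_sym:
  assumes "x \<in> M_seq" "y \<in> M_seq"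
  shows "d_p (x, t) (y, s) = d_p (y, s) (x, t)"
proof -
  have "d_p (x, t) (y, s) < r \<longleftrightarrow> d_p (y, s) (x, t) < r" for r
    using assms island_sym[OF assms(1), of y]
    by (simp add: d_p_less_iff abs_minus_commute add.commute)
  then show ?thesis by (meson linorder_less_linear order_less_irrefl)
qed

lemma d_p_le_gate:
  assumes "x \<in> M_seq" "y \<in> island k x" "u \<in> I_dyadic k"
  shows "d_p (x, t) (y, s) \<le> \<bar>t - u\<bar> + \<bar>u - s\<bar>"
proof (rule ccontr)
  assume "\<not> ?thesis"
  then have "d_p (x, t) (y, s) < d_p (x, t) (y, s)"
    using assms island_subset d_p_less_iff[of x y t s "d_p (x, t) (y, s)"] by (auto simp: not_le)
  then show False by simp
qed

text \<open>A gate of level \<open>k\<close> is within \<open>1 / 2 ^ k\<close> of every height. Hence the topology of \<open>d_p\<close> is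
  coarser than the product topology.\<close>

lemma d_p_le_island:
  assumes "x \<in> M_seq" "y \<in> island k x" "t \<in> {0..1}"
  shows "d_p (x, t) (y, s) \<le> \<bar>t - s\<bar> + 2 / 2 ^ k"
proof -
  obtain u where u: "u \<in> I_dyadic k" "\<bar>t - u\<bar> < 1 / 2 ^ k" using I_dyadic_approx assms by blast
  have "2 / 2 ^ k = 1 / 2 ^ k + 1 / (2::real) ^ k" by (simp add: add_divide_distrib[symmetric])
  then show ?thesis using d_p_le_gate[OF assms(1,2) u(1), of t s] u(2) by linarith
qed

lemma d_p_same:
  assumes x: "x \<in> M_seq" and t: "t \<in> {0..1}"
  shows "d_p (x, t) (x, s) = \<bar>t - s\<bar>"
proof (rule antisym)
  show "\<bar>t - s\<bar> \<le> d_p (x, t) (x, s)" using x by (intro d_p_ge)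
  show "d_p (x, t) (x, s) \<le> \<bar>t - s\<bar>"
  proof (rule field_le_epsilon)
    fix e :: real assume "0 < e"
    then obtain k where k: "(1/2) ^ k < e / 2" using real_arch_pow_inv[of "e/2" "1/2"] by auto
    have "2 / 2 ^ k = 2 * (1/2::real) ^ k" by (simp add: power_divide)
    then show "d_p (x, t) (x, s) \<le> \<bar>t - s\<bar> + e"
      using d_p_le_island[OF x island_self[OF x] t, where k = k and s = s] k by linarith
  qed
qed

text \<open>The gate of the smaller level serves for the composed path, since all three sequences agree up
  to that level.\<close>

lemma d_p_triangle:
  assumes M: "x \<in> M_seq" "y \<in> M_seq" "z \<in> M_seq"
  shows "d_p (x, t) (z, v) \<le> d_p (x, t) (y, s) + d_p (y, s) (z, v)"
proof (rule field_le_epsilon)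
  fix e :: real assume e: "0 < e"
  obtain k a where a: "a \<in> I_dyadic k" "y \<in> island k x" "\<bar>t - a\<bar> + \<bar>a - s\<bar> < d_p (x, t) (y, s) + e / 2"
    using d_p_less_iff[OF M(1,2), of t s "d_p (x, t) (y, s) + e / 2"] e by auto
  obtain l b where b: "b \<in> I_dyadic l" "z \<in> island l y" "\<bar>s - b\<bar> + \<bar>b - v\<bar> < d_p (y, s) (z, v) + e / 2"
    using d_p_less_iff[OF M(2,3), of s v "d_p (y, s) (z, v) + e / 2"] e by auto
  show "d_p (x, t) (z, v) \<le> d_p (x, t) (y, s) + d_p (y, s) (z, v) + e"
  proof (cases "k \<le> l")
    case True
    then have "z \<in> island k x" using a b by (auto simp: island_def)
    then show ?thesis using d_p_le_gate[OF M(1) _ a(1), of z t v] a(3) b(3) by linarith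
  next
    case False
    then have "z \<in> island l x" using a b by (auto simp: island_def)
    then show ?thesis using d_p_le_gate[OF M(1) _ b(1), of z t v] a(3) b(3) by linarith
  qed
qed

lemma pseudometric_d_p: "pseudometric_on MI d_p"
  unfolding pseudometric_on_def
proof (intro conjI ballI)
  fix a b c assume "a \<in> MI" "b \<in> MI" "c \<in> MI"
  then show "d_p a c \<le> d_p a b + d_p b c"
    by (cases a; cases b; cases c) (auto simp: MI_def intro: d_p_triangle)
next
  fix a b assume "a \<in> MI" "b \<in> MI"
  then show "0 \<le> d_p a b" "d_p a b = d_p b a"
    by (cases a; cases b; auto simp: MI_def intro: d_p_nonneg d_p_sym)+
next
  fix a assume "a \<in> MI"
  then show "d_p a a = 0" by (cases a) (auto simp: MI_def d_p_same)
qed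

text \<open>A product of finite sets is compact, and convergence in a discrete factor means being
  eventually constant.\<close>

lemma M_seq_sequentially_compact:
  assumes x: "\<And>n. x n \<in> M_seq"
  obtains l r where "l \<in> M_seq" "strict_mono (r :: nat \<Rightarrow> nat)"
    "\<And>k. \<forall>\<^sub>F n in sequentially. x (r n) \<in> island k l"
proof -
  define F where "F = (\<lambda>i::nat. if i = 0 then {undefined} else {1..i})"
  have M: "M_seq = Pi\<^sub>E UNIV F"
    by (auto simp: M_seq_def PiE_def Pi_def extensional_def F_def not_less_eq_eq split: if_splits)
  have "compactin (product_topology (\<lambda>i. euclidean) UNIV) (Pi\<^sub>E UNIV F)"
    by (subst compactin_PiE) (auto simp: F_def intro: finite_imp_compact)
  then have "compact M_seq" by (simp add: M euclidean_product_topology)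
  then have "seq_compact M_seq" by (rule compact_imp_seq_compact)
  then obtain l r where l: "l \<in> M_seq" and r: "strict_mono r" and lim: "(x \<circ> r) \<longlonglongrightarrow> l"
    using x unfolding seq_compact_def by metis
  have coord: "\<forall>\<^sub>F n in sequentially. x (r n) i = l i" for i
  proof -
    have "(\<lambda>n. (x \<circ> r) n i) \<longlonglongrightarrow> l i" 
      by (rule continuous_on_tendsto_compose[OF continuous_on_product_coordinates[of i] lim]) auto
    then show ?thesis by (simp add: discrete_topology_class.tendsto_discrete o_def)
  qed
  have "\<forall>\<^sub>F n in sequentially. x (r n) \<in> island k l" for k
  proof -
    have "\<forall>\<^sub>F n in sequentially. \<forall>i\<in>{1..k}. x (r n) i = l i"
      using coord by (intro eventually_ball_finite) auto
    then show ?thesis by eventually_elim (use x in \<open>auto simp: island_def\<close>)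
  qed
  then show ?thesis using l r that by blast
qed

text \<open>Compactness of \<open>M\<close> and of the interval gives a convergent subsequence, which determines the limit of
  a Cauchy sequence.\<close>

lemma complete_d_p: "pm_complete MI d_p"
  unfolding pm_complete_def
proof (intro allI impI, elim conjE)
  fix \<sigma> :: "nat \<Rightarrow> (nat \<Rightarrow> nat) \<times> real"
  assume \<sigma>: "range \<sigma> \<subseteq> MI" and Cauchy: "\<forall>\<epsilon>>0. \<exists>N. \<forall>m\<ge>N. \<forall>n\<ge>N. d_p (\<sigma> m) (\<sigma> n) < \<epsilon>"
  define x where "x = (\<lambda>n. fst (\<sigma> n))"
  define t where "t = (\<lambda>n. snd (\<sigma> n))"
  have xt: "x n \<in> M_seq" "t n \<in> {0..1}" "\<sigma> n = (x n, t n)" for n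
    using \<sigma> by (auto simp: x_def t_def MI_def image_subset_iff mem_Times_iff)
  obtain l r where l: "l \<in> M_seq" and r: "strict_mono (r :: nat \<Rightarrow> nat)"
    and lr: "\<And>k. \<forall>\<^sub>F n in sequentially. x (r n) \<in> island k l"
    using M_seq_sequentially_compact[of x] xt by blast
  have "Cauchy t"
    unfolding Cauchy_def
  proof (intro allI impI)
    fix e :: real assume "0 < e"
    then obtain N where N: "\<forall>m\<ge>N. \<forall>n\<ge>N. d_p (\<sigma> m) (\<sigma> n) < e" using Cauchy by blast
    show "\<exists>N. \<forall>m\<ge>N. \<forall>n\<ge>N. dist (t m) (t n) < e"
    proof (intro exI[of _ N] allI impI)
      fix m n assume "N \<le> m" "N \<le> n"
      then have "d_p (x m, t m) (x n, t n) < e" using N xt by metis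
      then show "dist (t m) (t n) < e"
        using d_p_ge[OF xt(1) xt(1), of "t m" "t n" m n] by (simp add: dist_real_def)
    qed
  qed
  then obtain s where s: "t \<longlonglongrightarrow> s" using Cauchy_convergent convergent_def by blast
  have s01: "s \<in> {0..1}"
    using xt(2) by (intro closed_sequentially[OF _ _ s]) auto
  have tr: "(\<lambda>n. t (r n)) \<longlonglongrightarrow> s" using LIMSEQ_subseq_LIMSEQ[OF s r] by (simp add: o_def)
  have "(\<lambda>n. d_p (\<sigma> n) (l, s)) \<longlonglongrightarrow> 0"
  proof (rule tendstoI)
    fix e :: real assume e: "0 < e"
    obtain N where N: "\<forall>m\<ge>N. \<forall>n\<ge>N. d_p (\<sigma> m) (\<sigma> n) < e / 3" using Cauchy e by (meson divide_pos_pos zero_less_numeral)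
    obtain k where k: "(1/2) ^ k < e / 6" using real_arch_pow_inv[of "e/6" "1/2"] e by auto
    have two: "2 / 2 ^ k = 2 * (1/2::real) ^ k" by (simp add: power_divide)
    have "\<forall>\<^sub>F m in sequentially. \<bar>s - t (r m)\<bar> < e / 3"
      using tendstoD[OF tr, of "e/3"] e by (simp add: dist_real_def abs_minus_commute)
    with lr[of k] eventually_ge_at_top[of N]
    have "\<forall>\<^sub>F m in sequentially. N \<le> r m \<and> d_p (l, s) (x (r m), t (r m)) < 2 * e / 3"
    proof eventually_elim
      case (elim m)
      then show ?case using d_p_le_island[OF l _ s01, of "x (r m)" k "t (r m)"] seq_suble[OF r, of m] k two
        by auto
    qed
    then obtain m where m: "N \<le> r m" "d_p (l, s) (x (r m), t (r m)) < 2 * e / 3"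
      by (auto simp: eventually_sequentially)
    show "\<forall>\<^sub>F n in sequentially. dist (d_p (\<sigma> n) (l, s)) 0 < e"
      using eventually_ge_at_top[of N]
    proof eventually_elim
      case (elim n)
      then have "d_p (x n, t n) (x (r m), t (r m)) < e / 3" using N m(1) xt(3) by metis
      then show ?case
        using d_p_triangle[OF xt(1) xt(1) l, of n "t n" s "r m" "t (r m)"] m(2)
          d_p_sym[OF l xt(1), of s "r m" "t (r m)"] d_p_nonneg[OF xt(1) l, of n "t n" s]
        by (simp add: xt(3) dist_real_def)
    qed
  qed
  then show "\<exists>a\<in>MI. (\<lambda>n. d_p (\<sigma> n) a) \<longlonglongrightarrow> 0"
    using l s01 by (intro bexI[of _ "(l, s)"]) (auto simp: MI_def)
qed

lemma separable_d_p: "pm_separable MI d_p"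
proof -
  define c where "c = (\<lambda>J::(nat \<Rightarrow> nat) set. SOME a. a \<in> J)"
  define S where "S = c ` (islands - {{}}) \<times> (\<rat> \<inter> {0..1::real})"
  show ?thesis
    unfolding pm_separable_def
  proof (intro exI[of _ S] conjI ballI allI impI)
    show "countable S"
      unfolding S_def using countable_islands countable_rat
      by (intro countable_SIGMA countable_image) auto
    have c: "c J \<in> J" if "J \<in> islands - {{}}" for J
      using that unfolding c_def by (metis DiffD2 insertCI someI_ex equals0I)
    then show "S \<subseteq> MI" using islands_Pow by (auto simp: S_def MI_def)
    fix z \<epsilon> assume z: "z \<in> MI" and \<epsilon>: "(0::real) < \<epsilon>"
    obtain x t where xt: "z = (x, t)" "x \<in> M_seq" "t \<in> {0..1}" using z by (auto simp: MI_def)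
    obtain k where k: "(1/2) ^ k < \<epsilon> / 4" using real_arch_pow_inv[of "\<epsilon>/4" "1/2"] \<epsilon> by auto
    have two: "2 / 2 ^ k = 2 * (1/2::real) ^ k" by (simp add: power_divide)
    have isl: "island k x \<in> islands - {{}}" using island_in_islands[OF xt(2)] island_self[OF xt(2)] by blast
    obtain u where u: "u \<in> I_dyadic k" "\<bar>t - u\<bar> < 1 / 2 ^ k" using I_dyadic_approx xt by blast
    have "u \<in> \<rat> \<inter> {0..1}" using u(1) I_dyadic_subset[OF u(1)] by (auto simp: I_dyadic_def)
    then have "(c (island k x), u) \<in> S" using isl by (auto simp: S_def)
    moreover have "d_p z (c (island k x), u) < \<epsilon>"
    proof -
      have "1 / 2 ^ k = (1/2::real) ^ k" by (simp add: power_divide)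
      then show ?thesis
        using d_p_le_island[OF xt(2) c[OF isl] xt(3), of u] u(2) k two \<epsilon> unfolding xt(1) by linarith
    qed
    ultimately show "\<exists>s\<in>S. d_p z s < \<epsilon>" by blast
  qed
qed

section \<open>The product measure\<close>

definition leb_I :: "real measure" where
  "leb_I = restrict_space lborel {0..1}"

lemma space_leb_I: "space leb_I = {0..1}"
  and sets_leb_I: "sets leb_I = {A. A \<in> sets borel \<and> A \<subseteq> {0..1}}"
  by (auto simp: leb_I_def space_restrict_space sets_restrict_space_iff) (meson atLeastAtMost_iff subsetD)+

lemma emeasure_leb_I: "A \<in> sets borel \<Longrightarrow> A \<subseteq> {0..1} \<Longrightarrow> emeasure leb_I A = emeasure lborel A"
  unfolding leb_I_def by (subst emeasure_restrict_space) auto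

lemma prob_space_leb_I: "prob_space leb_I"
  by (rule prob_spaceI) (simp add: space_leb_I emeasure_leb_I)

interpretation MI: pair_prob_space nu leb_I
  by (intro pair_prob_space.intro pair_sigma_finite.intro prob_space_imp_sigma_finite prob_space_nu prob_space_leb_I)

lemma mu_eq: "mu = nu \<Otimes>\<^sub>M leb_I"
  by (simp add: mu_def leb_I_def)

lemma space_mu: "space mu = MI"
  by (simp add: mu_eq space_pair_measure space_nu space_leb_I MI_def)

text \<open>An open set is a union of boxes, and countably many boxes with rational end points suffice.\<close>

lemma pm_open_MI_sets:
  assumes U: "pm_open MI d_p U"
  shows "U \<in> sets mu"
proof -
  define R where "R = (\<lambda>(J :: (nat \<Rightarrow> nat) set, p, q). J \<times> ({p<..<q} \<inter> {0..1::real}))"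
  define T where "T = {i \<in> islands \<times> \<rat> \<times> \<rat>. R i \<subseteq> U}"
  have "countable T"
    unfolding T_def using countable_islands countable_rat
    by (intro countable_Collect countable_SIGMA) auto
  moreover have "R i \<in> sets mu" if "i \<in> T" for i
  proof -
    obtain J p q where i: "i = (J, p, q)" by (cases i)
    have "J \<in> sets nu" using that island_sets by (auto simp: T_def islands_def i)
    then show ?thesis
      unfolding mu_eq i R_def prod.case by (intro pair_measureI) (auto simp: sets_leb_I)
  qed
  ultimately have "(\<Union>i\<in>T. R i) \<in> sets mu" by (intro sets.countable_UN') auto
  moreover have "U = (\<Union>i\<in>T. R i)"
  proof (intro equalityI subsetI)
    fix z assume z: "z \<in> U"
    have "z \<in> MI" using U z by (auto simp: pm_open_def)
    then obtain x t where xt: "z = (x, t)" "x \<in> M_seq" "t \<in> {0..1}" by (auto simp: MI_def)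
    obtain r where r: "0 < r" "pm_ball MI d_p z r \<subseteq> U" using U z by (auto simp: pm_open_def)
    obtain k where k: "(1/2) ^ k < r / 4" using real_arch_pow_inv[of "r/4" "1/2"] r by auto
    have two: "2 / 2 ^ k = 2 * (1/2::real) ^ k" by (simp add: power_divide)
    obtain p where p: "p \<in> \<rat>" "t - r / 2 < p" "p < t" using Rats_dense_in_real[of "t - r/2" t] r by auto
    obtain q where q: "q \<in> \<rat>" "t < q" "q < t + r / 2" using Rats_dense_in_real[of t "t + r/2"] r by auto
    have "R (island k x, p, q) \<subseteq> pm_ball MI d_p z r"
    proof
      fix w assume "w \<in> R (island k x, p, q)"
      then obtain y s where w: "w = (y, s)" "y \<in> island k x" "p < s" "s < q" "s \<in> {0..1}"
        by (auto simp: R_def)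
      have "\<bar>t - s\<bar> < r / 2" using w(3,4) p(2,3) q(2,3) by (simp only: abs_less_iff) linarith
      then have "d_p z w < r" using d_p_le_island[OF xt(2) w(2) xt(3), of s] k two by (simp add: xt(1) w(1))
      moreover have "w \<in> MI" using w island_subset by (auto simp: MI_def)
      ultimately show "w \<in> pm_ball MI d_p z r" by (simp add: pm_ball_def)
    qed
    then have "(island k x, p, q) \<in> T"
      using r p q island_in_islands[OF xt(2)] by (auto simp: T_def)
    moreover have "z \<in> R (island k x, p, q)"
      using p q xt island_self by (auto simp: R_def)
    ultimately show "z \<in> (\<Union>i\<in>T. R i)" by blast
  qed (auto simp: T_def)
  ultimately show ?thesis by simp
qed

lemma pm_open_ball: 
  assumes P: "pseudometric_on X d" and x: "x \<in> X"
  shows "pm_open X d (pm_ball X d x r)"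
  unfolding pm_open_def
proof (intro conjI ballI)
  fix y assume y: "y \<in> pm_ball X d x r"
  have "pm_ball X d y (r - d x y) \<subseteq> pm_ball X d x r"
  proof
    fix z assume z: "z \<in> pm_ball X d y (r - d x y)"
    then have "d x z \<le> d x y + d y z" using P x y by (auto simp: pseudometric_on_def pm_ball_def)
    then show "z \<in> pm_ball X d x r" using z by (auto simp: pm_ball_def)
  qed
  then show "\<exists>r'>0. pm_ball X d y r' \<subseteq> pm_ball X d x r"
    using y by (intro exI[of _ "r - d x y"]) (auto simp: pm_ball_def)
qed (auto simp: pm_ball_def)

lemma ball_sets: "z \<in> MI \<Longrightarrow> pm_ball MI d_p z r \<in> sets mu"
  by (intro pm_open_MI_sets pm_open_ball pseudometric_d_p)

lemma pm_measure_space_mu: "pm_measure_space MI d_p mu"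
  unfolding pm_measure_space_def
proof (intro conjI ballI)
  show "pm_borel_sets MI d_p \<subseteq> sets mu"
    unfolding pm_borel_sets_def space_mu[symmetric]
    using pm_open_MI_sets by (intro sets.sigma_sets_subset) (auto simp: space_mu)
  show "\<exists>r>0. emeasure mu (pm_ball MI d_p z r) < \<infinity>" for z
    using MI.P.emeasure_finite unfolding mu_eq by (intro exI[of _ 1]) (simp add: less_top[symmetric])
qed (simp_all add: pseudometric_d_p complete_d_p separable_d_p space_mu)

lemma vec1_Rn: "vec1 r \<in> Rn 1"
  by (simp add: topspace_Euclidean_space vec1_def)

lemma height_chart_is_chart: "is_chart MI d_p height_chart"
  unfolding height_chart_def is_chart_def prod.case
proof (intro conjI)
  have "pm_open MI d_p MI"
    unfolding pm_open_def by (intro conjI ballI exI[of _ 1]) (auto simp: pm_ball_def)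
  then show "MI \<in> pm_borel_sets MI d_p" by (auto simp: pm_borel_sets_def)
  show "(\<lambda>z. vec1 (height z)) \<in> MI \<rightarrow> Rn 1" using vec1_Rn by auto
  show "pm_lipschitz MI d_p (euclid_dist 1) (\<lambda>z. vec1 (height z))"
    unfolding pm_lipschitz_def
    by (intro exI[of _ 1]) (auto simp: euclid_dist_def L2_set_def vec1_def height_def MI_def intro: d_p_ge)
qed

section \<open>Almost every point is good\<close>

text \<open>Density at fixed height: the density theorem on \<open>M\<close> is applied to each horizontal section of
  \<open>A\<close>, and Fubini's theorem turns "for every \<open>t\<close> and almost every \<open>x\<close>" into "almost everywhere". Most of
  the proof establishes measurability.\<close>

lemma AE_island_density:
  assumes A: "A \<in> sets mu"
  shows "AE (x, t) in mu. (x, t) \<in> A \<longrightarrow> (\<forall>\<epsilon>>0. \<forall>\<^sub>F k in sequentially.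
           emeasure nu {y \<in> island k x. (y, t) \<notin> A} \<le> ennreal \<epsilon> * emeasure nu (island k x))"
proof -
  define w where "w = (\<lambda>k (z :: (nat \<Rightarrow> nat) \<times> real). emeasure nu {y \<in> island k (fst z). (y, snd z) \<notin> A})"
  define v where "v = (\<lambda>k (z :: (nat \<Rightarrow> nat) \<times> real). emeasure nu (island k (fst z)))"
  define P where "P = (\<lambda>z. z \<in> A \<longrightarrow> (\<forall>m::nat. \<exists>n. \<forall>k\<ge>n. w k z \<le> ennreal (inverse (real (Suc m))) * v k z))"
  note [measurable] = A measurable_nu_coordinate
  have fst_mu [measurable]: "fst \<in> measurable mu nu" and snd_mu [measurable]: "snd \<in> measurable mu leb_I"
    unfolding mu_eq by simp_all
  define Q where "Q = (\<lambda>k. {p \<in> space (mu \<Otimes>\<^sub>M nu). \<forall>i\<in>{1..k}. \<exists>c. snd p i = c \<and> fst (fst p) i = c})"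
  have coord: "(\<lambda>p. snd p i) \<in> measurable (mu \<Otimes>\<^sub>M nu) (count_space UNIV)"
     "(\<lambda>p. fst (fst p) i) \<in> measurable (mu \<Otimes>\<^sub>M nu) (count_space UNIV)" for i
    using measurable_compose[OF measurable_snd measurable_nu_coordinate]
      measurable_compose[OF measurable_compose[OF measurable_fst fst_mu] measurable_nu_coordinate] by simp_all
  note [measurable] = coord
  have Qs [measurable]: "Q k \<in> sets (mu \<Otimes>\<^sub>M nu)" for k
    unfolding Q_def by measurable
  have Q: "Pair z -` Q k = island k (fst z)" if "z \<in> MI" for z k
    using that by (auto simp: Q_def island_def space_pair_measure space_mu space_nu)
  define Q' where "Q' = (\<lambda>k. {p \<in> space (mu \<Otimes>\<^sub>M nu). p \<in> Q k \<and> (snd p, snd (fst p)) \<notin> A})"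
  have "(\<lambda>p. (snd p, snd (fst p))) \<in> measurable (mu \<Otimes>\<^sub>M nu) mu"
    by (subst (2) mu_eq) measurable
  note [measurable] = this
  have Q's: "Q' k \<in> sets (mu \<Otimes>\<^sub>M nu)" for k
    unfolding Q'_def by measurable
  have Q': "Pair z -` Q' k = {y \<in> island k (fst z). (y, snd z) \<notin> A}" if "z \<in> MI" for z k
    using that by (auto simp: Q'_def Q_def island_def space_pair_measure space_mu space_nu)
  have [measurable]: "v k \<in> borel_measurable mu" for k
    by (rule measurable_cong[THEN iffD2, OF _ MI.M1.measurable_emeasure_Pair[OF Qs[of k]]])
       (simp add: v_def Q space_mu)
  have [measurable]: "w k \<in> borel_measurable mu" for k
    by (rule measurable_cong[THEN iffD2, OF _ MI.M1.measurable_emeasure_Pair[OF Q's[of k]]])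
       (simp add: w_def Q' space_mu)
  have Pm: "{z \<in> space mu. P z} \<in> sets mu"
    unfolding P_def by measurable
  have ae: "AE x in nu. P (x, t)" if t: "t \<in> {0..1}" for t
  proof -
    have At: "(\<lambda>x. (x, t)) -` A \<in> sets nu" using A unfolding mu_eq by (rule sets_Pair2)
    show ?thesis
      using island_density[OF At]
    proof eventually_elim
      case (elim x)
      show ?case
        unfolding P_def
      proof (intro impI allI)
        fix m assume "(x, t) \<in> A"
        moreover have "{y \<in> island k x. (y, t) \<notin> A} = island k x - (\<lambda>x. (x, t)) -` A" for k by auto
        ultimately show "\<exists>n. \<forall>k\<ge>n. w k (x, t) \<le> ennreal (inverse (real (Suc m))) * v k (x, t)"
          using elim unfolding w_def v_def eventually_sequentially by simp
      qed
    qed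
  qed
  have "AE t in leb_I. AE x in nu. P (x, t)"
    by (rule AE_I2, rule ae) (simp only: space_leb_I)
  then have "AE x in nu. AE t in leb_I. P (x, t)"
    using Pm by (subst MI.AE_commute) (simp_all add: mu_eq)
  then have "AE z in mu. P z"
    using Pm unfolding mu_eq by (intro MI.AE_pair_measure) auto
  then show ?thesis
  proof (eventually_elim, clarify)
    fix x t and \<epsilon> :: real
    assume P: "P (x, t)" "(x, t) \<in> A" and "0 < \<epsilon>"
    then obtain m where m: "inverse (real (Suc m)) < \<epsilon>" using reals_Archimedean by blast
    obtain n where n: "\<And>k. n \<le> k \<Longrightarrow> w k (x, t) \<le> ennreal (inverse (real (Suc m))) * v k (x, t)"
      using P unfolding P_def by blast
    show "\<forall>\<^sub>F k in sequentially. emeasure nu {y \<in> island k x. (y, t) \<notin> A} \<le> ennreal \<epsilon> * emeasure nu (island k x)"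
      using eventually_ge_at_top[of n]
    proof eventually_elim
      case (elim k)
      have "w k (x, t) \<le> ennreal (inverse (real (Suc m))) * v k (x, t)" by (rule n[OF elim])
      also have "\<dots> \<le> ennreal \<epsilon> * v k (x, t)"
        using m by (intro mult_right_mono ennreal_leI) auto
      finally show ?case by (simp add: w_def v_def)
    qed
  qed
qed

text \<open>Points at which \<open>f\<close> is affine with slope \<open>q\<close>, with relative error \<open>\<eta>\<close>, on a vertical window of radius
  \<open>R\<close>. Unlike the set of points with a given derivative, it has a uniform \<open>R\<close>, which the comparison of nearby
  fibres needs.\<close>

definition near_linear ::
    "((nat \<Rightarrow> nat) \<times> real \<Rightarrow> real) \<Rightarrow> real \<Rightarrow> real \<Rightarrow> real \<Rightarrow> ((nat \<Rightarrow> nat) \<times> real) set" where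
  "near_linear f q \<eta> R = {(x, t) \<in> MI. \<forall>s\<in>{0..1}. \<bar>s - t\<bar> < R \<longrightarrow>
     \<bar>f (x, s) - f (x, t) - q * (s - t)\<bar> \<le> \<eta> * \<bar>s - t\<bar>}"

lemma lipschitz_d_p_cases:
  fixes f :: "(nat \<Rightarrow> nat) \<times> real \<Rightarrow> real"
  assumes "pm_lipschitz MI d_p dist f"
  obtains L where "0 \<le> L" "\<And>z w. z \<in> MI \<Longrightarrow> w \<in> MI \<Longrightarrow> \<bar>f z - f w\<bar> \<le> L * d_p z w"
    "\<And>x s t. x \<in> M_seq \<Longrightarrow> s \<in> {0..1} \<Longrightarrow> t \<in> {0..1} \<Longrightarrow> \<bar>f (x, s) - f (x, t)\<bar> \<le> L * \<bar>s - t\<bar>"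
proof -
  obtain L where L: "0 \<le> L" "\<And>z w. z \<in> MI \<Longrightarrow> w \<in> MI \<Longrightarrow> \<bar>f z - f w\<bar> \<le> L * d_p z w"
    using assms unfolding pm_lipschitz_def dist_real_def by blast
  moreover have "\<bar>f (x, s) - f (x, t)\<bar> \<le> L * \<bar>s - t\<bar>"
    if "x \<in> M_seq" "s \<in> {0..1}" "t \<in> {0..1}" for x s t
    using L(2)[of "(x, s)" "(x, t)"] that by (simp add: MI_def d_p_same)
  ultimately show ?thesis using that by blast
qed

lemma lipschitz_d_p_measurable:
  fixes f :: "(nat \<Rightarrow> nat) \<times> real \<Rightarrow> real"
  assumes f: "pm_lipschitz MI d_p dist f"
  shows "f \<in> borel_measurable mu"
  unfolding borel_measurable_iff_greater
proof
  fix a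
  obtain L where L: "0 \<le> L" "\<And>z w. z \<in> MI \<Longrightarrow> w \<in> MI \<Longrightarrow> \<bar>f z - f w\<bar> \<le> L * d_p z w"
    by (rule lipschitz_d_p_cases[OF f], rule that)
  have "pm_open MI d_p {z \<in> MI. a < f z}"
    unfolding pm_open_def
  proof (intro conjI ballI)
    fix z assume z: "z \<in> {z \<in> MI. a < f z}"
    define r where "r = (f z - a) / (L + 1)"
    have r: "0 < r" using z L by (simp add: r_def)
    have "pm_ball MI d_p z r \<subseteq> {z \<in> MI. a < f z}"
    proof
      fix w assume w: "w \<in> pm_ball MI d_p z r"
      then have wd: "w \<in> MI" "d_p z w < r" by (auto simp: pm_ball_def)
      have "L * d_p z w \<le> L * r" using wd L by (intro mult_left_mono) auto
      also have "\<dots> < (L + 1) * r" using r by (simp add: algebra_simps)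
      also have "\<dots> = f z - a" using L by (simp add: r_def)
      finally have "L * d_p z w < f z - a" .
      then show "w \<in> {z \<in> MI. a < f z}" using L(2)[of z w] z wd by auto
    qed
    then show "\<exists>r>0. pm_ball MI d_p z r \<subseteq> {z \<in> MI. a < f z}" using r by blast
  qed auto
  then show "{z \<in> space mu. a < f z} \<in> sets mu"
    unfolding space_mu by (rule pm_open_MI_sets)
qed

text \<open>By continuity on the fibre, rational heights suffice; this makes \<open>near_linear\<close> a countable
  intersection of measurable sets.\<close>

lemma near_linear_rational:
  assumes f: "pm_lipschitz MI d_p dist f" and z: "(x, t) \<in> MI"
    and rat: "\<And>s. s \<in> \<rat> \<Longrightarrow> s \<in> {0..1} \<Longrightarrow> \<bar>s - t\<bar> < R \<Longrightarrow>
       \<bar>f (x, s) - f (x, t) - q * (s - t)\<bar> \<le> \<eta> * \<bar>s - t\<bar>"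
  shows "(x, t) \<in> near_linear f q \<eta> R"
proof -
  have "\<bar>f (x, s) - f (x, t) - q * (s - t)\<bar> \<le> \<eta> * \<bar>s - t\<bar>" if s: "s \<in> {0..1}" "\<bar>s - t\<bar> < R" for s
  proof -
    have x: "x \<in> M_seq" and t: "t \<in> {0..1}" using z by (auto simp: MI_def)
    obtain L where L: "0 \<le> L" "\<And>s t. s \<in> {0..1} \<Longrightarrow> t \<in> {0..1} \<Longrightarrow> \<bar>f (x, s) - f (x, t)\<bar> \<le> L * \<bar>s - t\<bar>"
      using lipschitz_d_p_cases[OF f] x by metis
    have "L-lipschitz_on {0..1} (\<lambda>s. f (x, s))"
      using L by (intro lipschitz_onI) (auto simp: dist_real_def)
    then have cont: "continuous_on {0..1} (\<lambda>s. f (x, s))" by (rule lipschitz_on_continuous_on)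
    define C where "C = {s \<in> {0..1}. \<bar>f (x, s) - f (x, t) - q * (s - t)\<bar> \<le> \<eta> * \<bar>s - t\<bar>}"
    have "closed C"
      unfolding C_def by (intro continuous_on_closed_Collect_le continuous_intros cont)
    \<comment> \<open>The part of the window inside \<open>(0, 1)\<close>; its closure contains the whole window.\<close>
    define W where "W = {max 0 (t - R)<..<min 1 (t + R)}"
    have "0 < R" using s by linarith
    then have ne: "max 0 (t - R) < min 1 (t + R)" using t by auto
    have "W \<inter> \<rat> \<subseteq> C" using rat unfolding W_def C_def by (auto simp: abs_less_iff)
    then have "closure (W \<inter> \<rat>) \<subseteq> C" using \<open>closed C\<close> by (rule closure_minimal)
    moreover have "closure (W \<inter> \<rat>) = closure W"
      unfolding W_def by (intro closure_open_Int_superset) (auto simp: Rats_closure_real)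
    moreover have "closure W = {max 0 (t - R)..min 1 (t + R)}"
      unfolding W_def using ne by (rule closure_greaterThanLessThan)
    moreover have "s \<in> {max 0 (t - R)..min 1 (t + R)}" using s by (auto simp: abs_less_iff)
    ultimately have "s \<in> C" by blast
    then show ?thesis by (simp add: C_def)
  qed
  then show ?thesis using z by (auto simp: near_linear_def)
qed

lemma near_linear_sets:
  assumes f: "pm_lipschitz MI d_p dist f"
  shows "near_linear f q \<eta> R \<in> sets mu"
proof -
  have fm [measurable]: "f \<in> borel_measurable mu" by (rule lipschitz_d_p_measurable[OF f])
  have fst_mu [measurable]: "fst \<in> measurable mu nu"
    unfolding mu_eq by simp
  have "(\<lambda>t. t) \<in> borel_measurable leb_I"
    unfolding leb_I_def by (intro measurable_restrict_space1) simp
  then have snd_mu [measurable]: "snd \<in> borel_measurable mu"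
    unfolding mu_eq by (rule measurable_compose[OF measurable_snd])
  have fs: "(\<lambda>z. f (fst z, s)) \<in> borel_measurable mu" if "s \<in> {0..1}" for s
  proof (rule measurable_compose[OF _ fm])
    have "(\<lambda>z. s) \<in> measurable mu leb_I" using that by (simp add: space_leb_I)
    then have "(\<lambda>z. (fst z, s)) \<in> measurable mu (nu \<Otimes>\<^sub>M leb_I)" by (intro measurable_Pair fst_mu)
    then show "(\<lambda>z. (fst z, s)) \<in> measurable mu mu" by (simp only: mu_eq[symmetric])
  qed
  have "near_linear f q \<eta> R = {z \<in> space mu. \<forall>s\<in>\<rat> \<inter> {0..1}. \<bar>s - snd z\<bar> < R \<longrightarrow>
     \<bar>f (fst z, s) - f z - q * (s - snd z)\<bar> \<le> \<eta> * \<bar>s - snd z\<bar>}" (is "_ = ?S")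
  proof (intro equalityI subsetI)
    fix z assume "z \<in> ?S"
    then show "z \<in> near_linear f q \<eta> R"
      by (cases z) (auto simp: space_mu intro!: near_linear_rational[OF f])
  qed (auto simp: near_linear_def space_mu)
  also have "\<dots> = space mu \<inter> (\<Inter>s\<in>\<rat> \<inter> {0..1}. {z \<in> space mu. \<bar>s - snd z\<bar> < R \<longrightarrow>
     \<bar>f (fst z, s) - f z - q * (s - snd z)\<bar> \<le> \<eta> * \<bar>s - snd z\<bar>})"
    by blast
  also have "\<dots> \<in> sets mu"
  proof (intro sets.Int sets.top sets.countable_INT' image_subsetI countable_Int1 countable_rat)
    have "(0::real) \<in> \<rat> \<inter> {0..1}" by simp
    then show "\<rat> \<inter> {0..1::real} \<noteq> {}" by blast
    fix s :: real assume s: "s \<in> \<rat> \<inter> {0..1}"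
    then have [measurable]: "(\<lambda>z. f (fst z, s)) \<in> borel_measurable mu" by (intro fs) simp
    show "{z \<in> space mu. \<bar>s - snd z\<bar> < R \<longrightarrow>
     \<bar>f (fst z, s) - f z - q * (s - snd z)\<bar> \<le> \<eta> * \<bar>s - snd z\<bar>} \<in> sets mu"
      by measurable
  qed
  finally show ?thesis .
qed

lemma near_linear_if_derivative:
  assumes x: "x \<in> M_seq" and t: "t \<in> {0..1}"
    and h: "\<And>s. s \<in> {0..1} \<Longrightarrow> h s = f (x, s)"
    and der: "(h has_real_derivative l) (at t)" and \<eta>: "0 < \<eta>"
  shows "\<exists>q\<in>\<rat>. \<exists>m::nat. (x, t) \<in> near_linear f q \<eta> (inverse (real (Suc m)))"
proof -
  obtain q where q: "q \<in> \<rat>" "l < q" "q < l + \<eta> / 2" using Rats_dense_in_real[of l "l + \<eta>/2"] \<eta> by auto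
  have "((\<lambda>s. (h s - h t) / (s - t)) \<longlongrightarrow> l) (at t)"
    using der by (simp add: has_field_derivative_iff)
  then have "\<forall>\<^sub>F s in at t. dist ((h s - h t) / (s - t)) l < \<eta> / 2"
    using \<eta> by (intro tendstoD) auto
  then obtain d where d: "0 < d" "\<And>s. s \<noteq> t \<Longrightarrow> dist s t < d \<Longrightarrow> dist ((h s - h t) / (s - t)) l < \<eta> / 2"
    unfolding eventually_at by auto
  obtain m where m: "inverse (real (Suc m)) < d" using reals_Archimedean d by blast
  have "(x, t) \<in> near_linear f q \<eta> (inverse (real (Suc m)))"
    unfolding near_linear_def
  proof (intro CollectI case_prodI conjI ballI impI)
    show "(x, t) \<in> MI" using x t by (simp add: MI_def)
    fix s :: real assume s: "s \<in> {0..1}" "\<bar>s - t\<bar> < inverse (real (Suc m))"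
    show "\<bar>f (x, s) - f (x, t) - q * (s - t)\<bar> \<le> \<eta> * \<bar>s - t\<bar>"
    proof (cases "s = t")
      case False
      have "dist s t < d" using s m by (simp add: dist_real_def)
      then have "\<bar>(h s - h t) / (s - t) - l\<bar> < \<eta> / 2" using d(2)[OF False] by (simp add: dist_real_def)
      then have "\<bar>(h s - h t) / (s - t) - q\<bar> \<le> \<eta>" using q by linarith
      then have "\<bar>(h s - h t) / (s - t) - q\<bar> * \<bar>s - t\<bar> \<le> \<eta> * \<bar>s - t\<bar>"
        by (rule mult_right_mono) simp
      also have "\<bar>(h s - h t) / (s - t) - q\<bar> * \<bar>s - t\<bar> = \<bar>h s - h t - q * (s - t)\<bar>"
      proof -
        have "((h s - h t) / (s - t) - q) * (s - t) = h s - h t - q * (s - t)"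
          using False by (simp add: divide_simps)
        then show ?thesis by (metis abs_mult)
      qed
      finally show ?thesis using s t by (simp add: h)
    qed simp
  qed
  then show ?thesis using q(1) by blast
qed

text \<open>Almost everywhere differentiability on each fibre, in a form that is measurable in both variables.\<close>

lemma AE_near_linear:
  assumes f: "pm_lipschitz MI d_p dist f"
  shows "AE z in mu. \<forall>n::nat. \<exists>q\<in>\<rat>. \<exists>m::nat. z \<in> near_linear f q (inverse (real (Suc n))) (inverse (real (Suc m)))"
proof -
  let ?P = "\<lambda>z. \<forall>n::nat. \<exists>q\<in>\<rat>. \<exists>m::nat. z \<in> near_linear f q (inverse (real (Suc n))) (inverse (real (Suc m)))"
  have m: "{z \<in> space mu. ?P z} \<in> sets mu"
  proof -
    have "{z \<in> space mu. ?P z} =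
        space mu \<inter> (\<Inter>n::nat. \<Union>q\<in>\<rat>. \<Union>m::nat. near_linear f q (inverse (real (Suc n))) (inverse (real (Suc m))))"
      by blast
    also have "\<dots> \<in> sets mu"
      by (intro sets.Int sets.top sets.countable_INT'[OF countableI_type] sets.countable_UN'[OF countable_rat]
            sets.countable_UN'[OF countableI_type] image_subsetI near_linear_sets[OF f]) simp
    finally show ?thesis .
  qed
  have ae: "AE t in leb_I. ?P (x, t)" if x: "x \<in> space nu" for x
  proof -
    have x: "x \<in> M_seq" using x by (simp add: space_nu)
    obtain L where L: "0 \<le> L" "\<And>s t. s \<in> {0..1} \<Longrightarrow> t \<in> {0..1} \<Longrightarrow> \<bar>f (x, s) - f (x, t)\<bar> \<le> L * \<bar>s - t\<bar>"
      using lipschitz_d_p_cases[OF f] x by metis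
    \<comment> \<open>Clamping extends the fibre function to a Lipschitz function on the line.\<close>
    define c where "c = (\<lambda>s::real. max 0 (min 1 s))"
    define h where "h = (\<lambda>s. f (x, c s))"
    have c: "c s \<in> {0..1}" "\<bar>c s - c t\<bar> \<le> \<bar>s - t\<bar>" for s t by (auto simp: c_def)
    have "L-lipschitz_on UNIV h"
    proof (rule lipschitz_onI)
      show "dist (h s) (h t) \<le> L * dist s t" for s t
        using L(2)[OF c(1) c(1), of s t] mult_left_mono[OF c(2) L(1), of s t]
        by (simp add: h_def dist_real_def)
    qed (rule L)
    then have "AE t in lborel. \<exists>l. (h has_real_derivative l) (at t)"
      by (rule lipschitz_AE_differentiable)
    then have "AE t in leb_I. t \<in> {0..1} \<and> (\<exists>l. (h has_real_derivative l) (at t))"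
      unfolding leb_I_def by (subst AE_restrict_space_iff) auto
    then show ?thesis
    proof eventually_elim
      case (elim t)
      then obtain l where l: "(h has_real_derivative l) (at t)" by blast
      have "h s = f (x, s)" if "s \<in> {0..1}" for s using that by (simp add: h_def c_def)
      then show ?case
        using elim by (intro allI near_linear_if_derivative[OF x _ _ l]) auto
    qed
  qed
  have "AE x in nu. AE t in leb_I. ?P (x, t)" by (rule AE_I2) (rule ae)
  then show ?thesis using m unfolding mu_eq by (intro MI.AE_pair_measure)
qed

lemma finite_I_dyadic: "finite (I_dyadic k)"
proof -
  have "I_dyadic k = (\<lambda>n. real_of_int n / 2 ^ k) ` {0..2 ^ k}" by (auto simp: I_dyadic_def)
  then show ?thesis by simp
qed

lemma AE_not_dyadic: "AE z in mu. snd z \<in> {0..1} - (\<Union>k. I_dyadic k)"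
proof -
  let ?D = "\<Union>k. I_dyadic k"
  have "countable ?D" using finite_I_dyadic by (intro countable_UN) (auto intro: countable_finite)
  then have "AE t in lborel. t \<notin> ?D" by (intro AE_not_in countable_imp_null_set_lborel)
  then have "AE t in leb_I. t \<in> {0..1} - ?D"
    unfolding leb_I_def by (subst AE_restrict_space_iff) auto
  moreover have "{z \<in> space mu. snd z \<in> {0..1} - ?D} \<in> sets mu"
  proof -
    have "?D \<in> sets borel" by (rule sets.countable[OF _ \<open>countable ?D\<close>]) simp
    then have "{0..1} - ?D \<in> sets borel" by (intro sets.Diff) simp_all
    then have "{0..1} - ?D \<in> sets leb_I" unfolding sets_leb_I by blast
    moreover have "snd \<in> measurable mu leb_I" unfolding mu_eq by simp
    ultimately have "snd -` ({0..1} - ?D) \<inter> space mu \<in> sets mu" by (intro measurable_sets)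
    moreover have "snd -` ({0..1} - ?D) \<inter> space mu = {z \<in> space mu. snd z \<in> {0..1} - ?D}" by blast
    ultimately show ?thesis by (simp only:)
  qed
  ultimately show ?thesis
    unfolding mu_eq by (intro MI.AE_pair_measure) (simp_all only: snd_conv AE_I2)
qed

section \<open>Existence of the approximate derivative\<close>

lemma euclid_inner_height:
  "euclid_inner 1 D (\<lambda>i. vec1 (height z) i - vec1 (height w) i) = D 0 * (snd z - snd w)"
  by (simp add: euclid_inner_def vec1_def height_def case_prod_beta)

lemma has_approx_derivative_height_iff:
  "has_approx_derivative MI d_p mu height_chart f w D \<longleftrightarrow> D \<in> Rn 1 \<and>
     has_approx_limit MI d_p mu {z \<in> MI. d_p z w \<noteq> 0}
       (\<lambda>z. \<bar>f z - f w - D 0 * (snd z - snd w)\<bar> / d_p z w) w 0"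
  unfolding has_approx_derivative_def height_chart_def prod.case euclid_inner_height ..

lemma tendsto_ennreal_0I:
  fixes g :: "'a \<Rightarrow> ennreal"
  assumes "\<And>e. 0 < e \<Longrightarrow> \<forall>\<^sub>F r in F. g r \<le> ennreal e"
  shows "(g \<longlongrightarrow> 0) F"
proof (rule order_tendstoI)
  fix a :: ennreal assume "0 < a"
  then obtain b where b: "0 < b" "b < a" using dense by blast
  then obtain e where e: "b = ennreal e" "0 < e" by (cases b) (auto simp: top_unique)
  have "\<forall>\<^sub>F r in F. g r \<le> ennreal e" by (rule assms[OF e(2)])
  then show "\<forall>\<^sub>F r in F. g r < a" by (rule eventually_mono) (use b e in auto)
qed auto

lemma ennreal_divide_le_if_le_mult:
  fixes a b c :: ennreal
  assumes "a \<le> c * b"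
  shows "a / b \<le> c"
proof (cases "b = 0")
  case True
  then show ?thesis using assms by simp
next
  case False
  then show ?thesis using assms by (intro divide_le_posI_ennreal) (auto simp: zero_less_iff_neq_zero mult.commute)
qed

text \<open>A horizontal slice of a ball is a union of islands around the \<open>M\<close>-component of its centre, and
  hence a single island if it is nonempty.\<close>

lemma ball_slice:
  assumes "x \<in> M_seq" "s \<in> {0..1}"
  shows "(\<lambda>y. (y, s)) -` pm_ball MI d_p (x, t) r =
     (\<Union>k\<in>{k. \<exists>u\<in>I_dyadic k. \<bar>t - u\<bar> + \<bar>u - s\<bar> < r}. island k x)" (is "?L = ?R")
proof -
  have "y \<in> ?L \<longleftrightarrow> y \<in> ?R" for y
  proof (cases "y \<in> M_seq")
    case True
    then show ?thesis
      using assms d_p_less_iff[OF assms(1) True, of t s r] by (auto simp: pm_ball_def MI_def)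
  next
    case False
    then show ?thesis using subsetD[OF island_subset] by (auto simp: pm_ball_def MI_def)
  qed
  then show ?thesis by blast
qed

lemma Union_islands_Least:
  assumes "K \<noteq> {}"
  shows "(\<Union>k\<in>K. island k x) = island (LEAST k. k \<in> K) x"
proof
  show "(\<Union>k\<in>K. island k x) \<subseteq> island (LEAST k. k \<in> K) x"
    by (intro UN_least island_antimono Least_le)
  have "(LEAST k. k \<in> K) \<in> K" using assms by (meson LeastI_ex ex_in_conv)
  then show "island (LEAST k. k \<in> K) x \<subseteq> (\<Union>k\<in>K. island k x)" by blast
qed

text \<open>A set \<open>G\<close> that occupies a small fraction of all islands around \<open>x\<close> of level at least \<open>J\<close> also occupies
  a small fraction of a ball, provided the ball reaches no gate of lower level: the inequality holds
  on each slice, and is integrated over the heights.\<close>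

lemma emeasure_ball_fraction_le:
  fixes c :: ennreal
  assumes x: "x \<in> M_seq" "t \<in> {0..1}"
    and far: "\<And>k u. k < J \<Longrightarrow> u \<in> I_dyadic k \<Longrightarrow> r \<le> \<bar>t - u\<bar>"
    and G: "G \<in> sets nu"
    and le: "\<And>k. J \<le> k \<Longrightarrow> emeasure nu (island k x \<inter> G) \<le> c * emeasure nu (island k x)"
  shows "pm_ball MI d_p (x, t) r \<inter> G \<times> {0..1} \<in> sets mu"
    and "emeasure mu (pm_ball MI d_p (x, t) r \<inter> G \<times> {0..1}) \<le> c * emeasure mu (pm_ball MI d_p (x, t) r)"
proof -
  let ?B = "pm_ball MI d_p (x, t) r"
  have B: "?B \<in> sets (nu \<Otimes>\<^sub>M leb_I)" using ball_sets[of "(x, t)" r] x by (simp add: MI_def mu_eq)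
  have "{0..1} \<in> sets leb_I" by (simp add: sets_leb_I)
  then have GI: "G \<times> {0..1} \<in> sets (nu \<Otimes>\<^sub>M leb_I)" using G by (intro pair_measureI)
  have BG: "?B \<inter> G \<times> {0..1} \<in> sets (nu \<Otimes>\<^sub>M leb_I)" using B GI by (rule sets.Int)
  then show "?B \<inter> G \<times> {0..1} \<in> sets mu" by (simp add: mu_eq)
  have "emeasure nu ((\<lambda>y. (y, s)) -` (?B \<inter> G \<times> {0..1})) \<le> c * emeasure nu ((\<lambda>y. (y, s)) -` ?B)"
    if s: "s \<in> {0..1}" for s
  proof -
    define K where "K = {k. \<exists>u\<in>I_dyadic k. \<bar>t - u\<bar> + \<bar>u - s\<bar> < r}"
    have slice: "(\<lambda>y. (y, s)) -` ?B = (\<Union>k\<in>K. island k x)"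
      unfolding K_def by (rule ball_slice[OF x(1) s])
    have sliceG: "(\<lambda>y. (y, s)) -` (?B \<inter> G \<times> {0..1}) = (\<Union>k\<in>K. island k x) \<inter> G"
      using s unfolding slice[symmetric] by auto
    show ?thesis
    proof (cases "K = {}")
      case True
      then show ?thesis unfolding slice sliceG by simp
    next
      case False
      define k where "k = (LEAST k. k \<in> K)"
      have "k \<in> K" unfolding k_def using False by (meson LeastI_ex ex_in_conv)
      then obtain u where u: "u \<in> I_dyadic k" "\<bar>t - u\<bar> + \<bar>u - s\<bar> < r" unfolding K_def by blast
      have "J \<le> k"
      proof (rule ccontr)
        assume "\<not> J \<le> k"
        then have "r \<le> \<bar>t - u\<bar>" using u(1) by (intro far) auto
        then show False using u(2) by linarith
      qed
      moreover have "(\<Union>k\<in>K. island k x) = island k x"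
        unfolding k_def by (rule Union_islands_Least[OF False])
      ultimately show ?thesis unfolding slice sliceG using le by simp
    qed
  qed
  then have "(\<integral>\<^sup>+s. emeasure nu ((\<lambda>y. (y, s)) -` (?B \<inter> G \<times> {0..1})) \<partial>leb_I)
     \<le> (\<integral>\<^sup>+s. c * emeasure nu ((\<lambda>y. (y, s)) -` ?B) \<partial>leb_I)"
    by (intro nn_integral_mono) (simp only: space_leb_I)
  also have "\<dots> = c * (\<integral>\<^sup>+s. emeasure nu ((\<lambda>y. (y, s)) -` ?B) \<partial>leb_I)"
    by (intro nn_integral_cmult MI.measurable_emeasure_Pair2 B)
  finally show "emeasure mu (?B \<inter> G \<times> {0..1}) \<le> c * emeasure mu ?B"
    by (simp only: mu_eq MI.emeasure_pair_measure_alt2[OF B] MI.emeasure_pair_measure_alt2[OF BG])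
qed

text \<open>Below any given level there are only finitely many gates, so small balls around a
  nondyadic height involve only islands of high level.\<close>

lemma not_dyadic_far:
  assumes "t \<notin> (\<Union>k. I_dyadic k)"
  shows "\<exists>\<delta>>0. \<forall>k<J. \<forall>u\<in>I_dyadic k. \<delta> \<le> \<bar>t - u\<bar>"
proof -
  have "finite (\<Union>k\<in>{..<J}. I_dyadic k)" using finite_I_dyadic by blast
  then obtain \<delta> where \<delta>: "0 < \<delta>" "\<And>u. u \<in> (\<Union>k\<in>{..<J}. I_dyadic k) \<Longrightarrow> u \<noteq> t \<Longrightarrow> \<delta> \<le> dist t u"
    using finite_set_avoid by metis
  show ?thesis
  proof (intro exI[of _ \<delta>] conjI allI impI ballI)
    fix k u assume "k < J" "u \<in> I_dyadic k"
    moreover have "u \<noteq> t" using assms \<open>u \<in> I_dyadic k\<close> by blast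
    ultimately show "\<delta> \<le> \<bar>t - u\<bar>" using \<delta>(2)[of u] unfolding dist_real_def by blast
  qed (rule \<delta>)
qed

lemma not_dyadic_interior:
  assumes "t \<in> {0..1} - (\<Union>k. I_dyadic k)"
  shows "0 < t" "t < 1"
proof -
  have "0 \<in> I_dyadic 0" "1 \<in> I_dyadic 0" by (auto simp: I_dyadic_def)
  then have "t \<noteq> 0" "t \<noteq> 1" using assms by blast+
  then show "0 < t" "t < 1" using assms by auto
qed

lemma at_height_interior:
  assumes "0 < t" "t < (1::real)"
  shows "at 0 within {u. t + u \<in> {0..1}} = at 0"
proof -
  have "{u. t + u \<in> {0..1}} = {- t..1 - t}" by auto
  then show ?thesis using assms by (simp add: at_within_Icc_at)
qed

lemma near_linear_slope:
  assumes z: "(x, t) \<in> near_linear f q \<eta> R" and R: "0 < R" and t: "0 < t" "t < 1"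
  shows "\<forall>\<^sub>F u in at 0. \<bar>(f (x, t + u) - f (x, t)) / u - q\<bar> \<le> \<eta>"
proof -
  define \<delta> where "\<delta> = min R (min t (1 - t))"
  have "0 < \<delta>" using R t by (simp add: \<delta>_def)
  moreover have "\<bar>(f (x, t + u) - f (x, t)) / u - q\<bar> \<le> \<eta>" if u: "u \<noteq> 0" "dist u 0 < \<delta>" for u
  proof -
    have "\<bar>u\<bar> < R" "\<bar>u\<bar> < t" "\<bar>u\<bar> < 1 - t" using u(2) by (auto simp: \<delta>_def dist_real_def)
    then have "t + u \<in> {0..1}" "\<bar>(t + u) - t\<bar> < R" by auto
    then have "\<bar>f (x, t + u) - f (x, t) - q * u\<bar> \<le> \<eta> * \<bar>u\<bar>"
      using z unfolding near_linear_def by fastforce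
    then have "\<bar>f (x, t + u) - f (x, t) - q * u\<bar> / \<bar>u\<bar> \<le> \<eta>"
      using u by (simp add: divide_le_eq)
    moreover have "(f (x, t + u) - f (x, t)) / u - q = (f (x, t + u) - f (x, t) - q * u) / u"
      using u by (simp add: diff_divide_distrib)
    ultimately show ?thesis by (simp add: abs_divide)
  qed
  ultimately show ?thesis unfolding eventually_at by auto
qed

lemma derivative_if_near_linear:
  assumes t: "0 < t" "t < 1"
    and nl: "\<And>n::nat. \<exists>q R. 0 < R \<and> (x, t) \<in> near_linear f q (inverse (real (Suc n))) R"
  shows "\<exists>l. ((\<lambda>u. (f (x, t + u) - f (x, t)) / u) \<longlongrightarrow> l) (at 0)"
proof -
  obtain p R where "0 < R" "(x, t) \<in> near_linear f p (inverse (real (Suc 0))) R" using nl by blast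
  then have p: "\<forall>\<^sub>F u in at 0. \<bar>(f (x, t + u) - f (x, t)) / u - p\<bar> \<le> inverse (real (Suc 0))"
    using t by (intro near_linear_slope)
  have bounded: "\<forall>\<^sub>F u in at 0. \<bar>(f (x, t + u) - f (x, t)) / u\<bar> \<le> \<bar>p\<bar> + 1"
    using p
  proof eventually_elim
    case (elim u)
    then show ?case using abs_triangle_ineq[of "(f (x, t + u) - f (x, t)) / u - p" p] by simp
  qed
  show ?thesis
  proof (rule tendsto_if_no_oscillation[OF _ bounded])
    fix a b :: real assume "a < b"
    then obtain n where n: "inverse (real (Suc n)) < (b - a) / 2"
      using reals_Archimedean[of "(b - a) / 2"] by auto
    obtain q R where "0 < R" "(x, t) \<in> near_linear f q (inverse (real (Suc n))) R" using nl by blast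
    then have ev: "\<forall>\<^sub>F u in at 0. \<bar>(f (x, t + u) - f (x, t)) / u - q\<bar> \<le> inverse (real (Suc n))"
      using t by (intro near_linear_slope)
    show "\<not> ((\<exists>\<^sub>F u in at 0. (f (x, t + u) - f (x, t)) / u < a) \<and> (\<exists>\<^sub>F u in at 0. b < (f (x, t + u) - f (x, t)) / u))"
    proof (cases "q \<le> (a + b) / 2")
      case True
      have "\<forall>\<^sub>F u in at 0. \<not> b < (f (x, t + u) - f (x, t)) / u"
        using ev
      proof eventually_elim
        case (elim u)
        then show ?case using True n unfolding abs_le_iff by argo
      qed
      then show ?thesis by (simp add: frequently_def)
    next
      case False
      have "\<forall>\<^sub>F u in at 0. \<not> (f (x, t + u) - f (x, t)) / u < a"
        using ev
      proof eventually_elim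
        case (elim u)
        then show ?case using False n unfolding abs_le_iff by argo
      qed
      then show ?thesis by (simp add: frequently_def)
    qed
  qed simp
qed

text \<open>The gate \<open>u\<close> below is optimal up to a factor 2, so \<open>|s - t| \<le> d\<close> and \<open>|u - t| < 2 d\<close>, where \<open>d\<close> is the
  distance of the two points. The vertical steps from \<open>t\<close> to \<open>s\<close> and from \<open>t\<close> to \<open>u\<close> over
  \<open>y\<close>, and from \<open>t\<close> to \<open>u\<close> over \<open>x\<close>, contribute the errors \<open>\<eta> d\<close>, \<open>2 \<eta> d\<close> and \<open>2 \<eta> d\<close>.\<close>

lemma gate_estimate:
  assumes f: "pm_lipschitz MI d_p dist f" and x: "x \<in> M_seq" "y \<in> M_seq" and t: "t \<in> {0..1}" "s \<in> {0..1}"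
    and nl: "(x, t) \<in> near_linear f q \<eta> R" "(y, t) \<in> near_linear f q \<eta> R"
    and d: "0 < d_p (y, s) (x, t)" "2 * d_p (y, s) (x, t) < R" and \<eta>: "0 \<le> \<eta>"
  shows "\<bar>f (y, s) - f (x, t) - q * (s - t)\<bar> \<le> 5 * \<eta> * d_p (y, s) (x, t)"
proof -
  define d where "d = d_p (y, s) (x, t)"
  have d0: "0 < d" "2 * d < R" using d by (auto simp: d_def)
  have "d_p (x, t) (y, s) < 2 * d" using d_p_sym[OF x(2,1), of s t] d0 by (simp add: d_def)
  then obtain k u where u: "u \<in> I_dyadic k" "y \<in> island k x" "\<bar>t - u\<bar> + \<bar>u - s\<bar> < 2 * d"
    using d_p_less_iff[OF x, of t s "2 * d"] by blast
  have u01: "u \<in> {0..1}" by (rule I_dyadic_subset[OF u(1)])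
  have st: "\<bar>s - t\<bar> \<le> d" unfolding d_def using x by (intro d_p_ge)
  have ut: "\<bar>u - t\<bar> < 2 * d" using u(3) by linarith
  obtain L where L: "0 \<le> L" "\<And>z w. z \<in> MI \<Longrightarrow> w \<in> MI \<Longrightarrow> \<bar>f z - f w\<bar> \<le> L * d_p z w"
    by (rule lipschitz_d_p_cases[OF f], rule that)
  have "d_p (x, u) (y, u) \<le> 0" using d_p_le_gate[OF x(1) u(2,1), of u u] by simp
  then have "L * d_p (x, u) (y, u) \<le> 0" using L(1) by (simp add: mult_nonneg_nonpos)
  then have gate: "f (x, u) = f (y, u)" using L(2)[of "(x, u)" "(y, u)"] x u01 by (simp add: MI_def)
  have e1: "\<bar>f (y, s) - f (y, t) - q * (s - t)\<bar> \<le> \<eta> * d"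
  proof -
    have "\<bar>f (y, s) - f (y, t) - q * (s - t)\<bar> \<le> \<eta> * \<bar>s - t\<bar>"
      using nl(2) t(2) st d0 unfolding near_linear_def by auto
    also have "\<dots> \<le> \<eta> * d" using st \<eta> by (rule mult_left_mono)
    finally show ?thesis .
  qed
  have e: "\<bar>f (v, u) - f (v, t) - q * (u - t)\<bar> \<le> 2 * \<eta> * d" if "(v, t) \<in> near_linear f q \<eta> R" for v
  proof -
    have "\<bar>f (v, u) - f (v, t) - q * (u - t)\<bar> \<le> \<eta> * \<bar>u - t\<bar>"
      using that u01 ut d0 unfolding near_linear_def by auto
    also have "\<dots> \<le> \<eta> * (2 * d)" using ut \<eta> by (intro mult_left_mono) auto
    finally show ?thesis by (simp add: mult_ac)
  qed
  have "f (y, s) - f (x, t) - q * (s - t) = (f (y, s) - f (y, t) - q * (s - t))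
      - (f (y, u) - f (y, t) - q * (u - t)) + (f (x, u) - f (x, t) - q * (u - t))"
    using gate by simp
  then have "\<bar>f (y, s) - f (x, t) - q * (s - t)\<bar> \<le> \<eta> * d + 2 * \<eta> * d + 2 * \<eta> * d"
    using e1 e[OF nl(1)] e[OF nl(2)] by linarith
  then show ?thesis by (simp add: d_def)
qed

text \<open>Call \<open>y\<close> good if \<open>(y, t)\<close> lies in \<open>near_linear f q \<eta> R\<close>. At all points over a good \<open>y\<close> the error is at most \<open>5 \<eta> d\<close> for the slope \<open>q\<close>, hence at most
  \<open>6 \<eta> d\<close> for the slope \<open>l\<close>, and \<open>6 \<eta> < \<epsilon>\<close>. So the bad points of a small ball lie over the set \<open>G\<close>
  of those \<open>y\<close> that are not good.\<close>

lemma has_approx_derivativeI: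
  assumes f: "pm_lipschitz MI d_p dist f" and x: "x \<in> M_seq" and t: "t \<in> {0..1} - (\<Union>k. I_dyadic k)"
    and lim: "((\<lambda>u. (f (x, t + u) - f (x, t)) / u) \<longlongrightarrow> l) (at 0)"
    and nl: "\<And>n::nat. \<exists>q R. 0 < R \<and> (x, t) \<in> near_linear f q (inverse (real (Suc n))) R \<and>
       (\<forall>\<epsilon>>0. \<forall>\<^sub>F k in sequentially.
          emeasure nu {y \<in> island k x. (y, t) \<notin> near_linear f q (inverse (real (Suc n))) R}
            \<le> ennreal \<epsilon> * emeasure nu (island k x))"
  shows "has_approx_derivative MI d_p mu height_chart f (x, t) (vec1 l)"
  unfolding has_approx_derivative_height_iff
proof (intro conjI vec1_Rn)
  let ?g = "\<lambda>z. \<bar>f z - f (x, t) - vec1 l 0 * (snd z - snd (x, t))\<bar> / d_p z (x, t)"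
  let ?dom = "{z \<in> MI. d_p z (x, t) \<noteq> 0}"
  note t01 = not_dyadic_interior[OF t]
  show "has_approx_limit MI d_p mu ?dom ?g (x, t) 0"
    unfolding has_approx_limit_def
  proof (intro allI impI tendsto_ennreal_0I)
    fix \<epsilon> e :: real assume \<epsilon>: "0 < \<epsilon>" and e: "0 < e"
    obtain n where n: "inverse (real (Suc n)) < \<epsilon> / 6" using reals_Archimedean[of "\<epsilon> / 6"] \<epsilon> by auto
    define \<eta> where "\<eta> = inverse (real (Suc n))"
    have \<eta>: "0 < \<eta>" "6 * \<eta> < \<epsilon>" using n by (auto simp: \<eta>_def)
    obtain q R where R: "0 < R" and A: "(x, t) \<in> near_linear f q \<eta> R"
      and dens: "\<forall>\<^sub>F k in sequentially. emeasure nu {y \<in> island k x. (y, t) \<notin> near_linear f q \<eta> R}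
            \<le> ennreal e * emeasure nu (island k x)"
      using nl[of n] e unfolding \<eta>_def by blast
    have ql: "\<bar>l - q\<bar> \<le> \<eta>"
    proof (rule tendsto_upperbound)
      show "((\<lambda>u. \<bar>(f (x, t + u) - f (x, t)) / u - q\<bar>) \<longlongrightarrow> \<bar>l - q\<bar>) (at 0)"
        by (intro tendsto_intros lim)
      show "\<forall>\<^sub>F u in at 0. \<bar>(f (x, t + u) - f (x, t)) / u - q\<bar> \<le> \<eta>"
        by (rule near_linear_slope[OF A R t01])
    qed simp
    obtain J where J: "\<And>k. J \<le> k \<Longrightarrow> emeasure nu {y \<in> island k x. (y, t) \<notin> near_linear f q \<eta> R}
            \<le> ennreal e * emeasure nu (island k x)"
      using dens unfolding eventually_sequentially by blast
    obtain \<delta> where \<delta>: "0 < \<delta>" "\<And>k u. k < J \<Longrightarrow> u \<in> I_dyadic k \<Longrightarrow> \<delta> \<le> \<bar>t - u\<bar>"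
      using not_dyadic_far[OF Diff_iff[THEN iffD1, THEN conjunct2, OF t], of J] by (elim exE conjE) (rule that, assumption, blast)
    define G where "G = M_seq - (\<lambda>y. (y, t)) -` near_linear f q \<eta> R"
    have "(\<lambda>y. (y, t)) -` near_linear f q \<eta> R \<in> sets nu"
      using near_linear_sets[OF f] unfolding mu_eq by (rule sets_Pair2)
    then have G: "G \<in> sets nu"
      unfolding G_def space_nu[symmetric] by (intro sets.Diff sets.top)
    have G_isl: "island k x \<inter> G = {y \<in> island k x. (y, t) \<notin> near_linear f q \<eta> R}" for k
      using island_subset[of k x] by (auto simp: G_def)
    \<comment> \<open>Below \<open>\<delta>\<close>, the ball avoids gates of level less than \<open>J\<close>; below \<open>R / 2\<close>, \<open>gate_estimate\<close> applies to it.\<close>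
    have "\<forall>\<^sub>F r in at_right 0. r < min \<delta> (R / 2)"
      unfolding eventually_at_right_field using \<delta>(1) R by (intro exI[of _ "min \<delta> (R / 2)"]) simp
    then show "\<forall>\<^sub>F r in at_right 0. outer_measure_of mu {z \<in> pm_ball MI d_p (x, t) r \<inter> ?dom. \<bar>?g z - 0\<bar> > \<epsilon>} /
        emeasure mu (pm_ball MI d_p (x, t) r) \<le> ennreal e"
    proof eventually_elim
      case (elim r)
      let ?B = "pm_ball MI d_p (x, t) r"
      have far: "r \<le> \<bar>t - u\<bar>" if "k < J" "u \<in> I_dyadic k" for k u
        using \<delta>(2)[OF that] elim by simp
      have le: "emeasure nu (island k x \<inter> G) \<le> ennreal e * emeasure nu (island k x)" if "J \<le> k" for k
        using J[OF that] by (simp only: G_isl)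
      have tI: "t \<in> {0..1}" using t by blast
      note fraction = emeasure_ball_fraction_le[OF x tI far G le]
      have "{z \<in> ?B \<inter> ?dom. \<bar>?g z - 0\<bar> > \<epsilon>} \<subseteq> ?B \<inter> G \<times> {0..1}"
      proof
        fix z assume z: "z \<in> {z \<in> ?B \<inter> ?dom. \<bar>?g z - 0\<bar> > \<epsilon>}"
        obtain y s where ys: "z = (y, s)" by (cases z)
        have yM: "y \<in> M_seq" "s \<in> {0..1}" using z by (auto simp: ys MI_def)
        define d where "d = d_p (y, s) (x, t)"
        have "d \<noteq> 0" "d < r" using z d_p_sym[OF x yM(1), of t s] by (auto simp: ys d_def pm_ball_def)
        then have d: "0 < d" "2 * d < R" using d_p_nonneg[OF yM(1) x, of s t] elim by (auto simp: d_def)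
        have "y \<in> G"
        proof (rule ccontr)
          assume "y \<notin> G"
          then have "(y, t) \<in> near_linear f q \<eta> R" using yM by (simp add: G_def)
          then have "\<bar>f (y, s) - f (x, t) - q * (s - t)\<bar> \<le> 5 * \<eta> * d"
            using gate_estimate[OF f x yM(1) tI yM(2) A] d \<eta> by (simp add: d_def)
          moreover have "\<bar>q * (s - t) - l * (s - t)\<bar> \<le> \<eta> * d"
          proof -
            have "\<bar>q * (s - t) - l * (s - t)\<bar> = \<bar>l - q\<bar> * \<bar>s - t\<bar>"
              by (simp add: left_diff_distrib[symmetric] abs_mult abs_minus_commute)
            also have "\<dots> \<le> \<eta> * d"
              using ql d_p_ge[OF yM(1) x, of s t] \<eta> by (intro mult_mono) (auto simp: d_def)
            finally show ?thesis .
          qed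
          ultimately have "\<bar>f (y, s) - f (x, t) - l * (s - t)\<bar> \<le> 6 * \<eta> * d" by linarith
          also have "\<dots> < \<epsilon> * d" using \<eta> d by simp
          finally have "\<bar>f (y, s) - f (x, t) - l * (s - t)\<bar> / d < \<epsilon>" using d by (simp add: divide_less_eq)
          moreover have "\<epsilon> < \<bar>f (y, s) - f (x, t) - l * (s - t)\<bar> / d"
            using z d by (simp add: ys d_def vec1_def)
          ultimately show False by simp
        qed
        then show "z \<in> ?B \<inter> G \<times> {0..1}" using z yM by (auto simp: ys)
      qed
      then have "outer_measure_of mu {z \<in> ?B \<inter> ?dom. \<bar>?g z - 0\<bar> > \<epsilon>} \<le> outer_measure_of mu (?B \<inter> G \<times> {0..1})"
        by (rule outer_measure_of_mono)
      also have "\<dots> = emeasure mu (?B \<inter> G \<times> {0..1})" by (rule outer_measure_of_eq[OF fraction(1)])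
      also have "\<dots> \<le> ennreal e * emeasure mu ?B" by (rule fraction(2))
      finally show ?case by (rule ennreal_divide_le_if_le_mult)
    qed
  qed
qed

section \<open>Uniqueness of the approximate derivative\<close>

lemma emeasure_lborel_shift:
  fixes S :: "real set"
  assumes "S \<in> sets borel"
  shows "emeasure lborel ((\<lambda>t. c + t) -` S) = emeasure lborel S"
proof -
  have "emeasure lborel S = emeasure (distr lborel borel ((+) c)) S" by (simp add: lborel_distr_plus)
  also have "\<dots> = emeasure lborel ((\<lambda>t. c + t) -` S)"
    using assms by (subst emeasure_distr) auto
  finally show ?thesis by simp
qed

text \<open>On each fibre, a point of the ball at height \<open>s\<close> with \<open>|s - t| < r / 4\<close> stays in the ball when it is moved by
  \<open>r / 2\<close> in the direction from \<open>t\<close> to its gate \<open>u\<close>: short of the gate this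
  shortens the detour, and beyond the gate the detour is direct, of length at most \<open>3 r / 4\<close>. So the inner part
  of the fibre is covered by two translates of the outer part.\<close>

lemma emeasure_ball_le_outer:
  assumes x: "x \<in> M_seq" and r: "0 < r" "r \<le> t" "r \<le> 1 - t"
  defines "B \<equiv> pm_ball MI d_p (x, t) r"
  defines "out \<equiv> {z \<in> B. r / 4 \<le> \<bar>snd z - t\<bar>}"
  shows "out \<in> sets mu" and "emeasure mu B \<le> 3 * emeasure mu out"
proof -
  have t: "t \<in> {0..1}" using r by auto
  have Bs: "B \<in> sets mu" unfolding B_def using x t by (intro ball_sets) (simp add: MI_def)
  have "(\<lambda>t. t) \<in> borel_measurable leb_I"
    unfolding leb_I_def by (intro measurable_restrict_space1) simp
  then have snd_mu [measurable]: "snd \<in> borel_measurable mu"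
    unfolding mu_eq by (rule measurable_compose[OF measurable_snd])
  have BM: "B \<subseteq> space mu" unfolding space_mu B_def pm_ball_def by blast
  have "{z \<in> space mu. r / 4 \<le> \<bar>snd z - t\<bar>} \<in> sets mu" by measurable
  then have "B \<inter> {z \<in> space mu. r / 4 \<le> \<bar>snd z - t\<bar>} \<in> sets mu" using Bs by (intro sets.Int)
  moreover have "B \<inter> {z \<in> space mu. r / 4 \<le> \<bar>snd z - t\<bar>} = out" using BM by (auto simp: out_def)
  ultimately show outs: "out \<in> sets mu" by simp
  have slice: "emeasure leb_I (Pair y -` B) \<le> 3 * emeasure leb_I (Pair y -` out)" for y
  proof -
    define S where "S = Pair y -` B"
    define T where "T = Pair y -` out"
    have S: "S \<in> sets leb_I" and T: "T \<in> sets leb_I"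
      using Bs outs unfolding S_def T_def mu_eq by (auto intro: sets_Pair1)
    have Sb: "S \<in> sets borel" "S \<subseteq> {0..1}" and Tb: "T \<in> sets borel" "T \<subseteq> {0..1}"
      using S T by (auto simp: sets_leb_I)
    have shift: "r / 2 + s \<in> T \<or> - (r / 2) + s \<in> T" if s: "s \<in> S" "\<bar>s - t\<bar> < r / 4" for s
    proof -
      have "(y, s) \<in> B" using s by (simp add: S_def)
      then have y: "y \<in> M_seq" and "d_p (x, t) (y, s) < r" by (auto simp: B_def pm_ball_def MI_def)
      then obtain k u where u: "u \<in> I_dyadic k" "y \<in> island k x" "\<bar>t - u\<bar> + \<bar>u - s\<bar> < r"
        using d_p_less_iff[OF x y, of t s r] by blast
      have in_T: "v \<in> T" if "v \<in> {0..1}" "r / 4 \<le> \<bar>v - t\<bar>" "\<bar>t - u\<bar> + \<bar>u - v\<bar> < r" for v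
        using that d_p_le_gate[OF x u(2,1), of t v] x y by (auto simp: T_def out_def B_def pm_ball_def MI_def)
      show ?thesis
      proof (cases "t \<le> u")
        case True
        have "0 \<le> r / 2 + s" "r / 2 + s \<le> 1" "r / 4 \<le> \<bar>r / 2 + s - t\<bar>" "\<bar>t - u\<bar> + \<bar>u - (r / 2 + s)\<bar> < r"
          using s(2) r u(3) True by linarith+
        then have "r / 2 + s \<in> T" by (intro in_T) simp_all
        then show ?thesis ..
      next
        case False
        have "0 \<le> - (r / 2) + s" "- (r / 2) + s \<le> 1" "r / 4 \<le> \<bar>- (r / 2) + s - t\<bar>" "\<bar>t - u\<bar> + \<bar>u - (- (r / 2) + s)\<bar> < r"
          using s(2) r u(3) False by linarith+
        then have "- (r / 2) + s \<in> T" by (intro in_T) simp_all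
        then show ?thesis ..
      qed
    qed
    have Ts: "(\<lambda>s. c + s) -` T \<in> sets borel" for c
      using Tb(1) by (rule measurable_sets_borel[rotated]) simp
    have "S \<subseteq> T \<union> ((\<lambda>s. r / 2 + s) -` T \<union> (\<lambda>s. - (r / 2) + s) -` T)"
    proof
      fix s assume s: "s \<in> S"
      show "s \<in> T \<union> ((\<lambda>s. r / 2 + s) -` T \<union> (\<lambda>s. - (r / 2) + s) -` T)"
      proof (cases "\<bar>s - t\<bar> < r / 4")
        case False
        then have "s \<in> T" using s by (simp add: S_def T_def out_def)
        then show ?thesis by blast
      qed (use shift[OF s] in blast)
    qed
    then have "emeasure lborel S \<le> emeasure lborel (T \<union> ((\<lambda>s. r / 2 + s) -` T \<union> (\<lambda>s. - (r / 2) + s) -` T))"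
      by (rule emeasure_mono) (unfold sets_lborel, intro sets.Un Ts Tb)
    also have "\<dots> \<le> emeasure lborel T + (emeasure lborel ((\<lambda>s. r / 2 + s) -` T) + emeasure lborel ((\<lambda>s. - (r / 2) + s) -` T))"
      by (intro order_trans[OF emeasure_subadditive] add_mono order_refl emeasure_subadditive; unfold sets_lborel; intro sets.Un Ts Tb)
    also have "\<dots> = (1 + (1 + 1)) * emeasure lborel T"
      by (simp only: emeasure_lborel_shift[OF Tb(1)] distrib_right mult_1_left)
    also have "\<dots> = 3 * emeasure lborel T" by simp
    finally show ?thesis
      using emeasure_leb_I[OF Sb] emeasure_leb_I[OF Tb] by (simp add: S_def T_def)
  qed
  have "emeasure mu B = (\<integral>\<^sup>+y. emeasure leb_I (Pair y -` B) \<partial>nu)"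
    using Bs unfolding mu_eq by (rule MI.M2.emeasure_pair_measure_alt)
  also have "\<dots> \<le> (\<integral>\<^sup>+y. 3 * emeasure leb_I (Pair y -` out) \<partial>nu)"
    by (intro nn_integral_mono slice)
  also have "\<dots> = 3 * (\<integral>\<^sup>+y. emeasure leb_I (Pair y -` out) \<partial>nu)"
    using outs unfolding mu_eq by (intro nn_integral_cmult MI.measurable_emeasure_Pair1)
  also have "(\<integral>\<^sup>+y. emeasure leb_I (Pair y -` out) \<partial>nu) = emeasure mu out"
    using outs unfolding mu_eq by (rule MI.M2.emeasure_pair_measure_alt[symmetric])
  finally show "emeasure mu B \<le> 3 * emeasure mu out" .
qed

lemma emeasure_ball_pos:
  assumes x: "x \<in> M_seq" and t: "0 < t" "t < 1" and r: "0 < r"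
  shows "0 < emeasure mu (pm_ball MI d_p (x, t) r)"
proof -
  obtain k where k: "(1/2) ^ k < r / 4" using real_arch_pow_inv[of "r/4" "1/2"] r by auto
  define k' where "k' = Suc k"
  have k': "2 / 2 ^ k' < r / 2"
  proof -
    have "2 / 2 ^ k' = (1/2::real) ^ k" by (simp add: k'_def power_divide)
    then show ?thesis using k r by linarith
  qed
  define b where "b = min 1 (t + r / 2)"
  have b: "t < b" "b \<le> 1" "b \<le> t + r / 2" using t r by (auto simp: b_def)
  have "island k' x \<times> {t<..<b} \<subseteq> pm_ball MI d_p (x, t) r"
  proof
    fix z assume "z \<in> island k' x \<times> {t<..<b}"
    then obtain y s where ys: "z = (y, s)" "y \<in> island k' x" "t < s" "s < b" by auto
    have "d_p (x, t) (y, s) \<le> \<bar>t - s\<bar> + 2 / 2 ^ k'" using t by (intro d_p_le_island[OF x ys(2)]) auto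
    also have "\<dots> < r" using ys b k' by linarith
    finally show "z \<in> pm_ball MI d_p (x, t) r"
      using ys b t subsetD[OF island_subset ys(2)] by (auto simp: pm_ball_def MI_def)
  qed
  then have "emeasure mu (island k' x \<times> {t<..<b}) \<le> emeasure mu (pm_ball MI d_p (x, t) r)"
    using x t by (intro emeasure_mono ball_sets) (auto simp: MI_def)
  moreover have "emeasure mu (island k' x \<times> {t<..<b}) = ennreal (1 / fact k') * ennreal (b - t)"
  proof -
    have I: "{t<..<b} \<in> sets leb_I" using t b by (auto simp: sets_leb_I)
    have "emeasure mu (island k' x \<times> {t<..<b}) = emeasure nu (island k' x) * emeasure leb_I {t<..<b}"
      unfolding mu_eq using island_sets I by (rule MI.M2.emeasure_pair_measure_Times)
    moreover have "emeasure nu (island k' x) = ennreal (1 / fact k')"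
      using is_island_measure_nu x by (simp add: is_island_measure_def k'_def)
    moreover have "emeasure leb_I {t<..<b} = ennreal (b - t)"
      using t b by (subst emeasure_leb_I) auto
    ultimately show ?thesis by simp
  qed
  moreover have "0 < ennreal (1 / fact k') * ennreal (b - t)"
    using b by (simp add: ennreal_zero_less_mult_iff)
  ultimately show ?thesis by simp
qed

lemma outer_measure_of_Un_le:
  assumes "A \<subseteq> space M" "B \<subseteq> space M"
  shows "outer_measure_of M (A \<union> B) \<le> outer_measure_of M A + outer_measure_of M B"
proof -
  obtain E F where E: "E \<in> sets M" "A \<subseteq> E" "outer_measure_of M A = emeasure M E"
    and F: "F \<in> sets M" "B \<subseteq> F" "outer_measure_of M B = emeasure M F"
    using outer_measure_of_attain[OF assms(1)] outer_measure_of_attain[OF assms(2)] by blast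
  have "outer_measure_of M (A \<union> B) \<le> outer_measure_of M (E \<union> F)"
    using E F by (intro outer_measure_of_mono) auto
  also have "\<dots> = emeasure M (E \<union> F)" using E F by simp
  also have "\<dots> \<le> emeasure M E + emeasure M F" using E F by (intro emeasure_subadditive)
  finally show ?thesis by (simp add: E F)
qed

text \<open>If the slopes differ by \<open>c\<close>, then at an outer point, where \<open>|s - t| \<ge> r / 4 > d / 4\<close>, at least one of the two
  quotients is larger than \<open>c / 16\<close>. For small \<open>r\<close> each quotient does this only on an eighth of the ball at
  most, so the outer part would fill at most a quarter of the ball, whereas it fills at least a third.\<close>

lemma has_approx_derivative_unique:
  assumes x: "x \<in> M_seq" and t: "0 < t" "t < 1"
    and D: "has_approx_derivative MI d_p mu height_chart f (x, t) D"
    and E: "has_approx_derivative MI d_p mu height_chart f (x, t) E"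
  shows "D = E"
proof -
  have "D 0 = E 0"
  proof (rule ccontr)
    assume ne: "D 0 \<noteq> E 0"
    define c where "c = \<bar>D 0 - E 0\<bar>"
    have c: "0 < c" using ne by (simp add: c_def)
    then have "0 < c / 16" by simp
    define dom where "dom = {z \<in> MI. d_p z (x, t) \<noteq> 0}"
    define g where "g = (\<lambda>D :: nat \<Rightarrow> real. \<lambda>z. \<bar>f z - f (x, t) - D 0 * (snd z - snd (x, t))\<bar> / d_p z (x, t))"
    define bad where "bad = (\<lambda>D r. {z \<in> pm_ball MI d_p (x, t) r \<inter> dom. \<bar>g D z - 0\<bar> > c / 16})"
    have ev: "\<forall>\<^sub>F r in at_right 0. outer_measure_of mu (bad D r) / emeasure mu (pm_ball MI d_p (x, t) r) < ennreal (1 / 8)"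
      if "has_approx_derivative MI d_p mu height_chart f (x, t) D" for D
    proof -
      have "has_approx_limit MI d_p mu dom (g D) (x, t) 0"
        using that unfolding has_approx_derivative_height_iff dom_def g_def by blast
      then have "((\<lambda>r. outer_measure_of mu (bad D r) / emeasure mu (pm_ball MI d_p (x, t) r)) \<longlongrightarrow> 0) (at_right 0)"
        using \<open>0 < c / 16\<close> unfolding has_approx_limit_def bad_def by blast
      then show ?thesis by (rule order_tendstoD) simp
    qed
    have "\<forall>\<^sub>F r in at_right (0::real). 0 < r \<and> r \<le> t \<and> r \<le> 1 - t"
      unfolding eventually_at_right_field using t by (intro exI[of _ "min t (1 - t)"]) auto
    with ev[OF D] ev[OF E]
    have "\<forall>\<^sub>F r in at_right (0::real). False"
    proof eventually_elim
      case (elim r)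
      define B where "B = pm_ball MI d_p (x, t) r"
      define out where "out = {z \<in> B. r / 4 \<le> \<bar>snd z - t\<bar>}"
      have r: "0 < r" "r \<le> t" "r \<le> 1 - t" using elim by auto
      have outs: "out \<in> sets mu" and B3: "emeasure mu B \<le> 3 * emeasure mu out"
        using emeasure_ball_le_outer[OF x r] by (simp_all add: out_def B_def)
      have pos: "0 < emeasure mu B" unfolding B_def by (rule emeasure_ball_pos[OF x t r(1)])
      have fin: "emeasure mu B < top"
        using MI.P.emeasure_finite by (simp add: mu_eq less_top[symmetric])
      have bad_le: "outer_measure_of mu (bad D r) \<le> ennreal (1 / 8) * emeasure mu B"
        if "outer_measure_of mu (bad D r) / emeasure mu B < ennreal (1 / 8)" for D
        using that pos fin by (simp add: divide_less_ennreal)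
      have bad_sub: "bad D r \<subseteq> space mu" for D unfolding bad_def pm_ball_def space_mu by blast
      have "out \<subseteq> bad D r \<union> bad E r"
      proof
        fix z assume z: "z \<in> out"
        obtain y s where ys: "z = (y, s)" by (cases z)
        define d where "d = d_p (y, s) (x, t)"
        have yM: "y \<in> M_seq" and zB: "z \<in> B" and far: "r / 4 \<le> \<bar>s - t\<bar>"
          using z by (auto simp: out_def B_def pm_ball_def MI_def ys)
        have dr: "d < r" using zB d_p_sym[OF yM x, of s t] by (simp add: d_def B_def pm_ball_def ys)
        have sd: "\<bar>s - t\<bar> \<le> d" unfolding d_def by (rule d_p_ge[OF yM x])
        have d0: "0 < d" using far sd r by linarith
        show "z \<in> bad D r \<union> bad E r"
        proof (rule ccontr)
          assume "z \<notin> bad D r \<union> bad E r"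
          then have "\<bar>f (y, s) - f (x, t) - D 0 * (s - t)\<bar> / d \<le> c / 16"
             "\<bar>f (y, s) - f (x, t) - E 0 * (s - t)\<bar> / d \<le> c / 16"
            using zB d0 unfolding bad_def g_def dom_def B_def[symmetric]
            by (auto simp: ys d_def B_def pm_ball_def not_less)
          then have "\<bar>f (y, s) - f (x, t) - D 0 * (s - t)\<bar> \<le> c / 16 * d"
             "\<bar>f (y, s) - f (x, t) - E 0 * (s - t)\<bar> \<le> c / 16 * d"
            using d0 by (simp_all only: pos_divide_le_eq)
          then have "\<bar>D 0 * (s - t) - E 0 * (s - t)\<bar> \<le> c / 8 * d" by linarith
          moreover have "\<bar>D 0 * (s - t) - E 0 * (s - t)\<bar> = c * \<bar>s - t\<bar>"
            by (simp add: c_def left_diff_distrib[symmetric] abs_mult)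
          moreover have "c / 8 * d < c / 8 * r" using dr c by simp
          moreover have "c * (r / 4) \<le> c * \<bar>s - t\<bar>" using far c by (intro mult_left_mono) auto
          moreover have "0 < c * r" using c r by simp
          ultimately show False by (simp add: field_simps)
        qed
      qed
      then have "emeasure mu out \<le> outer_measure_of mu (bad D r \<union> bad E r)"
        using outer_measure_of_mono[of out _ mu] outs by simp
      also have "\<dots> \<le> outer_measure_of mu (bad D r) + outer_measure_of mu (bad E r)"
        by (intro outer_measure_of_Un_le bad_sub)
      also have "\<dots> \<le> ennreal (1 / 8) * emeasure mu B + ennreal (1 / 8) * emeasure mu B"
        using elim by (intro add_mono bad_le) (simp_all add: B_def)
      finally have "emeasure mu B \<le> 3 * (ennreal (1 / 8) * emeasure mu B + ennreal (1 / 8) * emeasure mu B)"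
        using B3 by (meson mult_left_mono order_trans zero_le)
      moreover obtain w where w: "0 < w" "emeasure mu B = ennreal w"
        using pos fin by (cases "emeasure mu B") auto
      moreover have "(3::ennreal) = ennreal 3" by simp
      ultimately have "ennreal w \<le> ennreal (3 * (1 / 8 * w + 1 / 8 * w))"
        by (simp only: ennreal_mult[symmetric] ennreal_plus[symmetric] zero_le_numeral mult_nonneg_nonneg less_imp_le divide_nonneg_nonneg zero_le_one add_nonneg_nonneg)
      then show False using w by (simp add: ennreal_le_iff)
    qed
    then show False by (simp add: trivial_limit_at_right_real)
  qed
  moreover have "D i = 0" "E i = 0" if "1 \<le> i" for i
    using D E that unfolding has_approx_derivative_height_iff by (auto simp: topspace_Euclidean_space)
  ultimately show ?thesis by (metis ext less_one not_le)
qed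

section \<open>The approximate differentiability structure\<close>

lemma AE_has_approx_derivative:
  assumes f: "pm_lipschitz MI d_p dist f"
  shows "AE (x, t) in mu. x \<in> M_seq \<and> 0 < t \<and> t < 1 \<and> (\<exists>l.
        ((\<lambda>u. (f (x, t + u) - f (x, t)) / u) \<longlongrightarrow> l) (at 0 within {u. t + u \<in> {0..1}}) \<and>
        has_approx_derivative MI d_p mu height_chart f (x, t) (vec1 l))"
proof -
  let ?A = "\<lambda>q n m. near_linear f q (inverse (real (Suc n))) (inverse (real (Suc m)))"
  have "AE z in mu. \<forall>q\<in>\<rat>. \<forall>n m. case z of (x, t) \<Rightarrow> (x, t) \<in> ?A q n m \<longrightarrow> (\<forall>\<epsilon>>0. \<forall>\<^sub>F k in sequentially.
           emeasure nu {y \<in> island k x. (y, t) \<notin> ?A q n m} \<le> ennreal \<epsilon> * emeasure nu (island k x))"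
    by (simp only: AE_ball_countable[OF countable_rat] AE_all_countable)
       (intro ballI allI AE_island_density near_linear_sets[OF f])
  moreover have "AE z in mu. z \<in> MI" using AE_space[of mu] by (simp add: space_mu)
  ultimately show ?thesis using AE_near_linear[OF f] AE_not_dyadic
  proof eventually_elim
    case (elim z)
    obtain x t where z: "z = (x, t)" by (cases z)
    have x: "x \<in> M_seq" using elim(2) by (simp add: z MI_def)
    have t: "t \<in> {0..1} - (\<Union>k. I_dyadic k)" using elim(4) unfolding z by (simp only: snd_conv)
    note t01 = not_dyadic_interior[OF t]
    have nl: "\<exists>q R. 0 < R \<and> (x, t) \<in> near_linear f q (inverse (real (Suc n))) R \<and>
       (\<forall>\<epsilon>>0. \<forall>\<^sub>F k in sequentially.
          emeasure nu {y \<in> island k x. (y, t) \<notin> near_linear f q (inverse (real (Suc n))) R}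
            \<le> ennreal \<epsilon> * emeasure nu (island k x))" for n
    proof -
      obtain q m where q: "q \<in> \<rat>" "(x, t) \<in> ?A q n m" using elim(3) unfolding z by blast
      have "(\<forall>\<epsilon>>0. \<forall>\<^sub>F k in sequentially.
           emeasure nu {y \<in> island k x. (y, t) \<notin> ?A q n m} \<le> ennreal \<epsilon> * emeasure nu (island k x))"
        using elim(1) q unfolding z prod.case by blast
      moreover have "0 < inverse (real (Suc m))" by simp
      ultimately show ?thesis using q(2) by blast
    qed
    then obtain l where l: "((\<lambda>u. (f (x, t + u) - f (x, t)) / u) \<longlongrightarrow> l) (at 0)"
      using derivative_if_near_linear[OF t01, of x f] by blast
    have "has_approx_derivative MI d_p mu height_chart f (x, t) (vec1 l)"
      by (rule has_approx_derivativeI[OF f x t l nl])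
    then show ?case using x t01 l at_height_interior[OF t01] unfolding z by auto
  qed
qed

theorem theorem5p1:
  shows "approx_diff_space MI d_p mu \<and>
    approx_diff_structure MI d_p mu {height_chart} \<and>
    (\<forall>f :: (nat \<Rightarrow> nat) \<times> real \<Rightarrow> real. pm_lipschitz MI d_p dist f \<longrightarrow>
      (AE (x\<^sub>0, t\<^sub>0) in mu. \<exists>l.
        ((\<lambda>u. (f (x\<^sub>0, t\<^sub>0 + u) - f (x\<^sub>0, t\<^sub>0)) / u) \<longlongrightarrow> l) (at 0 within {u. t\<^sub>0 + u \<in> {0..1}}) \<and>
        has_approx_derivative MI d_p mu height_chart f (x\<^sub>0, t\<^sub>0) (vec1 l)))"
proof -
  have unique: "AE z in mu. z \<in> MI \<longrightarrow> (\<exists>!D. has_approx_derivative MI d_p mu height_chart f z D)"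
    if f: "pm_lipschitz MI d_p dist f" for f :: "(nat \<Rightarrow> nat) \<times> real \<Rightarrow> real"
    using AE_has_approx_derivative[OF f]
  proof eventually_elim
    case (elim z)
    obtain x t where z: "z = (x, t)" by (cases z)
    from elim obtain l where "x \<in> M_seq" "0 < t" "t < 1"
        "has_approx_derivative MI d_p mu height_chart f (x, t) (vec1 l)"
      unfolding z prod.case by blast
    then show ?case using has_approx_derivative_unique[of x t f] unfolding z by blast
  qed
  have struct: "approx_diff_structure MI d_p mu {height_chart}"
    unfolding approx_diff_structure_def
  proof (intro conjI allI impI ballI)
    fix f :: "(nat \<Rightarrow> nat) \<times> real \<Rightarrow> real" and c assume f: "pm_lipschitz MI d_p dist f" and "c \<in> {height_chart}"
    then show "case c of (n, U, \<phi>) \<Rightarrow> AE z in mu. z \<in> U \<longrightarrow> (\<exists>!D. has_approx_derivative MI d_p mu (n, U, \<phi>) f z D)"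
      using unique[OF f] by (simp add: height_chart_def)
  qed (simp_all add: height_chart_is_chart disjoint_family_on_def, simp add: height_chart_def)
  moreover have "approx_diff_space MI d_p mu"
    using struct pm_measure_space_mu unfolding approx_diff_space_def by blast
  moreover have "AE (x\<^sub>0, t\<^sub>0) in mu. \<exists>l.
        ((\<lambda>u. (f (x\<^sub>0, t\<^sub>0 + u) - f (x\<^sub>0, t\<^sub>0)) / u) \<longlongrightarrow> l) (at 0 within {u. t\<^sub>0 + u \<in> {0..1}}) \<and>
        has_approx_derivative MI d_p mu height_chart f (x\<^sub>0, t\<^sub>0) (vec1 l)"
    if "pm_lipschitz MI d_p dist f" for f :: "(nat \<Rightarrow> nat) \<times> real \<Rightarrow> real"
    using AE_has_approx_derivative[OF that] by eventually_elim auto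
  ultimately show ?thesis by blast
qed

end
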